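(* Fix an integer $d\ge0$, let $f_d(r)$ be the number of $d$-dimensional faces of the Kostka polytope $P_r$ ($r\ge1$), and set $d_{\min}=\left\lfloor\frac{d+3}{2}\right\rfloor$. Then for all $r\ge1$, $$f_d(r)=\sum_{k=d_{\min}}^{3d+3}\alpha_k\binom{r}{k},$$ where $\alpha_k=f_d(k)-\sum_{j=d_{\min}}^{k-1}\binom{k}{j}\alpha_j$ for $k>d_{\min}$, and $$\alpha_{d_{\min}}=f_d(d_{\min})=\begin{cases}\frac{3d+5}{2}&\text{if } d \text{ is odd and } d>1,\\ 1&\text{if } d \text{ is even},\\ 3&\text{if } d=1.\end{cases}$$
   Context: For a positive integer $r$, a partition with at most $r$ parts is written as a non-increasing $r$-tuple of nonnegative integers; $\mathrm{Par}_r(n)$ is the set of such tuples with entries summing to $n$. For $\lambda,\mu\in\mathrm{Par}_r(n)$, $\lambda$ dominates $\mu$ if $\sum_{i=1}^k\lambda_i\ge\sum_{i=1}^k\mu_i$ for all $k\le r$. The $r$-Kostka cone $\mathcal{K}_r\subseteq\mathbb{R}^{2r}$ is the convex hull of all points $(\lambda_1,\dots,\lambda_r,\mu_1,\dots,\mu_r)$ with $\lambda,\mu\in\mathrm{Par}_r(n)$ for some $n$ and $\lambda$ dominating $\mu$. The Kostka polytope $P_r$ is the $(2r-2)$-dimensional polytope $\mathcal{K}_r\cap\{x:\sum_{i=1}^r(\lambda_i+\mu_i)=1\}$. *)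

theory Defs
  imports "HOL-Analysis.Analysis" "HOL-Analysis.Finite_Function_Topology"
begin

definition Par :: "nat \<Rightarrow> nat \<Rightarrow> nat list set" where
  "Par r n = {p. length p = r \<and> sorted_wrt (\<ge>) p \<and> sum_list p = n}"

definition dominates :: "nat list \<Rightarrow> nat list \<Rightarrow> bool" where
  "dominates p q \<longleftrightarrow> (\<forall>k\<le>length p. sum_list (take k p) \<ge> sum_list (take k q))"

text \<open>
  Since \<open>r\<close> varies, all spaces \<open>\<real>\<^bsup>2r\<^esup> = \<real>\<^bsup>r\<^esup> \<times> \<real>\<^bsup>r\<^esup>\<close> are realised as coordinate subspaces of the
  real vector space of pairs of finitely supported sequences: \<open>(x, y)\<close> stands for
  \<open>(x\<^sub>0, \<dots>, x\<^sub>r\<^sub>-\<^sub>1, y\<^sub>0, \<dots>, y\<^sub>r\<^sub>-\<^sub>1)\<close>, all other coordinates being zero. Faces and affine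
  dimension do not depend on the ambient space.
\<close>

type_synonym seq_pair = "(nat \<Rightarrow>\<^sub>0 real) \<times> (nat \<Rightarrow>\<^sub>0 real)"

definition tuple_vec :: "nat list \<Rightarrow> (nat \<Rightarrow>\<^sub>0 real)" where
  "tuple_vec p = Poly_Mapping.nth (map real p)"

definition Kostka_cone :: "nat \<Rightarrow> seq_pair set" where
  "Kostka_cone r = convex hull
     {(tuple_vec p, tuple_vec q) | p q. (\<exists>n. p \<in> Par r n \<and> q \<in> Par r n) \<and> dominates p q}"

definition Kostka_polytope :: "nat \<Rightarrow> seq_pair set" where
  "Kostka_polytope r = Kostka_cone r \<inter>
     {(x, y). (\<Sum>i<r. Poly_Mapping.lookup x i + Poly_Mapping.lookup y i) = 1}"

text \<open>
  The library's \<open>aff_dim\<close> is restricted to \<open>euclidean_space\<close>; this is its defining property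
  over an arbitrary real vector space. As \<open>d + 1 > 0\<close>, the set \<open>B\<close> is finite and nonempty.
\<close>

definition has_aff_dim :: "'a::real_vector set \<Rightarrow> nat \<Rightarrow> bool" where
  "has_aff_dim S d \<longleftrightarrow>
     (\<exists>B. affine hull B = affine hull S \<and> \<not> affine_dependent B \<and> card B = d + 1)"

definition num_faces :: "nat \<Rightarrow> nat \<Rightarrow> nat" where
  "num_faces d r = card {F. F face_of Kostka_polytope r \<and> has_aff_dim F d}"

definition d_min :: "nat \<Rightarrow> nat" where
  "d_min d = (d + 3) div 2"

text \<open>For \<open>k = d_min d\<close> the sum is empty, so the equation also gives the initial value.\<close>

function alpha :: "nat \<Rightarrow> nat \<Rightarrow> int" where
  "alpha d k = int (num_faces d k) - (\<Sum>j\<in>{d_min d..<k}. int (k choose j) * alpha d j)"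
  by pat_completeness auto
termination by (relation "inv_image less_than snd") auto

declare alpha.simps [simp del]

end

theory Submission
  imports Defs
begin

text \<open>
  View a point \<open>(\<lambda>, \<mu>)\<close> of the cone through the prefix sums of \<open>\<lambda>\<close> and \<open>\<mu>\<close>, two concave functions on
  \<open>{0..r}\<close> with the same end points. A face is determined by the set \<open>L\<close> of break points of \<open>\<lambda>\<close>, the
  set \<open>D\<close> where the dominance inequality is strict, and the set \<open>N\<close> of break points of \<open>\<mu>\<close> inside \<open>D\<close>;
  outside \<open>D\<close> the break points of \<open>\<mu>\<close> are forced. A triple occurs iff every maximal interval of \<open>D\<close>
  meets \<open>L\<close>, and the face then has dimension \<open>|L| + |N| - 1\<close>.

  Scanning the positions \<open>1..r\<close> with a three-state automaton (outside \<open>D\<close>; inside an interval of \<open>D\<close>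
  that has not yet met \<open>L\<close>; inside one that has) gives linear recurrences in \<open>r\<close> for the number of
  triples with \<open>|L| + |N| = e\<close>. In the difference equations the only moves that do not increase \<open>e\<close>
  go from the third state to the first and from the first to the second, so at most two of them can
  follow each other; hence this number is an integer combination of the \<open>r choose k\<close> with
  \<open>k \<le> 3 e\<close>. The coefficients are then forced to be the \<open>alpha d k\<close>.
\<close>

subsection \<open>Polyhedra in real vector spaces\<close>

text \<open>Applying \<open>\<sigma>\<close> to a linear combination of points of \<open>S\<close>
  gives the sum of its coefficients, so the combination lies on the slice exactly when it is
  affine.\<close>

lemma affine_hull_eq_span_slice:
  fixes \<sigma> :: "'a::real_vector \<Rightarrow> real"
  assumes "linear \<sigma>" and S: "\<And>v. v \<in> S \<Longrightarrow> \<sigma> v = 1"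
  shows "affine hull S = {v \<in> span S. \<sigma> v = 1}"
proof
  have "affine {v \<in> span S. \<sigma> v = 1}"
    unfolding affine_def
    by (auto simp: linear_add[OF \<open>linear \<sigma>\<close>] linear_scale[OF \<open>linear \<sigma>\<close>] span_add span_scale)
  then show "affine hull S \<subseteq> {v \<in> span S. \<sigma> v = 1}"
    by (intro hull_minimal) (auto simp: S span_base)
next
  show "{v \<in> span S. \<sigma> v = 1} \<subseteq> affine hull S"
  proof clarify
    fix v assume "v \<in> span S" "\<sigma> v = 1"
    then obtain t u where t: "finite t" "t \<subseteq> S" and v: "v = (\<Sum>a\<in>t. u a *\<^sub>R a)"
      unfolding span_explicit by blast
    have "\<sigma> v = (\<Sum>a\<in>t. u a * \<sigma> a)"
      by (simp add: v linear_sum[OF \<open>linear \<sigma>\<close>] linear_scale[OF \<open>linear \<sigma>\<close>])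
    also have "\<dots> = sum u t"
      using S t by (intro sum.cong) auto
    finally have "sum u t = 1" using \<open>\<sigma> v = 1\<close> by simp
    moreover from this have "t \<noteq> {}" by auto
    ultimately show "v \<in> affine hull S"
      using t v unfolding affine_hull_explicit by blast
  qed
qed

text \<open>By the same computation, the coefficients of a linear relation on the slice add up to 0,
  so it is an affine relation.\<close>

lemma independent_slice:
  fixes \<sigma> :: "'a::real_vector \<Rightarrow> real"
  assumes "linear \<sigma>" and B: "\<And>v. v \<in> B \<Longrightarrow> \<sigma> v = 1" and "\<not> affine_dependent B"
  shows "independent B"
proof
  assume "dependent B"
  then obtain t u where t: "finite t" "t \<subseteq> B" "(\<Sum>v\<in>t. u v *\<^sub>R v) = 0" "\<exists>v\<in>t. u v \<noteq> 0"
    unfolding dependent_explicit by blast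
  have "0 = \<sigma> (\<Sum>v\<in>t. u v *\<^sub>R v)"
    using t linear_0[OF \<open>linear \<sigma>\<close>] by simp
  also have "\<dots> = (\<Sum>a\<in>t. u a * \<sigma> a)"
    by (simp add: linear_sum[OF \<open>linear \<sigma>\<close>] linear_scale[OF \<open>linear \<sigma>\<close>])
  also have "\<dots> = sum u t"
    using B t by (intro sum.cong) auto
  finally have "affine_dependent B"
    unfolding affine_dependent_explicit using t by auto
  with assms show False by blast
qed

text \<open>On the hyperplane \<open>\<sigma> v = 1\<close> affine bases and linear bases coincide,
  so the affine dimension of a face can be read off from \<open>dim\<close>.\<close>

lemma has_aff_dim_iff_dim:
  fixes \<sigma> :: "'a::real_vector \<Rightarrow> real"
  assumes \<sigma>: "linear \<sigma>" and S: "\<And>v. v \<in> S \<Longrightarrow> \<sigma> v = 1"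
  shows "has_aff_dim S d \<longleftrightarrow> dim S = d + 1"
proof
  assume "has_aff_dim S d"
  then obtain B where B: "affine hull B = affine hull S" "\<not> affine_dependent B" "card B = d + 1"
    unfolding has_aff_dim_def by blast
  have \<sigma>B: "\<sigma> v = 1" if "v \<in> B" for v
    using hull_inc[OF that, of affine] B(1) affine_hull_eq_span_slice[OF \<sigma> S] by auto
  have "span B = span S"
    using B(1) hull_subset[of B affine] hull_subset[of S affine]
      affine_hull_subset_span[of B] affine_hull_subset_span[of S]
    by (metis order_trans span_eq)
  with independent_slice[OF \<sigma> \<sigma>B B(2)] B(3) show "dim S = d + 1"
    using dim_eq_card by metis
next
  assume d: "dim S = d + 1"
  obtain B where B: "B \<subseteq> S" "independent B" "S \<subseteq> span B" "card B = dim S"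
    using basis_exists by blast
  have "span B = span S"
    using B by (metis span_mono span_minimal subspace_span subset_antisym)
  then have "affine hull B = affine hull S"
    using affine_hull_eq_span_slice[OF \<sigma> S] affine_hull_eq_span_slice[OF \<sigma>, of B] S B(1) by auto
  then show "has_aff_dim S d"
    unfolding has_aff_dim_def using B d affine_dependent_imp_dependent by metis
qed

text \<open>The \<open>\<phi> i\<close> are coordinate functionals for the \<open>e i\<close>.
  Duality gives independence; subtracting from \<open>w\<close> its expansion with coefficients
  \<open>\<phi> i w\<close> leaves a vector of \<open>W\<close> killed by every
  \<open>\<phi> i\<close>, which is 0 by \<open>zero\<close>.\<close>

lemma dim_dual_basis:
  fixes e :: "'i \<Rightarrow> 'a::real_vector" and \<phi> :: "'i \<Rightarrow> 'a \<Rightarrow> real"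
  assumes "finite I" "subspace W" and e: "\<And>i. i \<in> I \<Longrightarrow> e i \<in> W"
    and \<phi>: "\<And>i. linear (\<phi> i)"
    and dual: "\<And>i j. i \<in> I \<Longrightarrow> j \<in> I \<Longrightarrow> \<phi> i (e j) = (if i = j then 1 else 0)"
    and zero: "\<And>w. w \<in> W \<Longrightarrow> (\<And>i. i \<in> I \<Longrightarrow> \<phi> i w = 0) \<Longrightarrow> w = 0"
  shows "dim W = card I"
proof (rule dim_unique)
  show "e ` I \<subseteq> W" using e by auto
  have \<phi>_sum: "\<phi> i (\<Sum>j\<in>I. c j *\<^sub>R e j) = c i" if "i \<in> I" for c i
  proof -
    have "\<phi> i (\<Sum>j\<in>I. c j *\<^sub>R e j) = (\<Sum>j\<in>I. c j * \<phi> i (e j))"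
      by (simp add: linear_sum[OF \<phi>] linear_scale[OF \<phi>])
    also have "\<dots> = (\<Sum>j\<in>I. if i = j then c j else 0)"
      using dual that by (intro sum.cong) auto
    finally show ?thesis using that \<open>finite I\<close> by simp
  qed
  have inj: "inj_on e I"
    using dual by (intro inj_onI) (metis zero_neq_one)
  then show "card (e ` I) = card I" by (rule card_image)
  show "W \<subseteq> span (e ` I)"
  proof
    fix w assume w: "w \<in> W"
    let ?s = "\<Sum>j\<in>I. \<phi> j w *\<^sub>R e j"
    have "w - ?s = 0"
      using w e \<open>subspace W\<close> \<phi>_sum
      by (intro zero) (auto intro!: subspace_diff subspace_sum subspace_scale simp: linear_diff[OF \<phi>])
    moreover have "?s \<in> span (e ` I)"
      by (intro span_sum span_scale span_base) auto
    ultimately show "w \<in> span (e ` I)" by simp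
  qed
  show "independent (e ` I)"
    unfolding independent_explicit_finite_subsets
  proof (intro allI impI ballI)
    fix A u v assume A: "A \<subseteq> e ` I" "finite A" "(\<Sum>v\<in>A. u v *\<^sub>R v) = 0" and v: "v \<in> A"
    \<comment> \<open>The coefficients move from vectors to indices, with 0 for vectors outside
      \<open>A\<close>, so that \<open>\<phi>_sum\<close> applies.\<close>
    define c where "c i = (if e i \<in> A then u (e i) else 0)" for i
    obtain i where i: "i \<in> I" "v = e i" using A v by auto
    have "(\<Sum>j\<in>I. c j *\<^sub>R e j) = (\<Sum>v\<in>e ` I. (if v \<in> A then u v else 0) *\<^sub>R v)"
      by (simp add: sum.reindex[OF inj] c_def)
    also have "\<dots> = (\<Sum>v\<in>A. u v *\<^sub>R v)"
      using A \<open>finite I\<close> by (intro sum.mono_neutral_cong_right) auto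
    finally have "\<phi> i 0 = c i" using \<phi>_sum[OF i(1), of c] A by simp
    then show "u v = 0" using i v linear_0[OF \<phi>] by (simp add: c_def)
  qed
qed

text \<open>Where \<open>a i\<close> is positive, continuity leaves room for a small step; where it
  is 0, the direction \<open>b i\<close> vanishes too.\<close>

lemma small_perturbation:
  fixes a b :: "'i \<Rightarrow> real"
  assumes "finite I" "\<And>i. i \<in> I \<Longrightarrow> 0 \<le> a i" "\<And>i. i \<in> I \<Longrightarrow> a i = 0 \<Longrightarrow> b i = 0"
  shows "\<exists>\<epsilon>>0. \<forall>i\<in>I. 0 \<le> a i + \<epsilon> * b i"
proof -
  have "\<forall>\<^sub>F \<epsilon> in at_right 0. 0 \<le> a i + \<epsilon> * b i" if "i \<in> I" for i
  proof (cases "a i = 0")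
    case True
    then show ?thesis using assms(3)[OF that] by simp
  next
    case False
    with assms(2)[OF that] have "0 < a i + 0 * b i" by simp
    moreover have "((\<lambda>\<epsilon>. a i + \<epsilon> * b i) \<longlongrightarrow> a i + 0 * b i) (at_right 0)"
      by (intro tendsto_intros)
    ultimately have "\<forall>\<^sub>F \<epsilon> in at_right 0. 0 < a i + \<epsilon> * b i"
      by (rule order_tendstoD(1)[rotated])
    then show ?thesis by (rule eventually_mono) simp
  qed
  then have "\<forall>\<^sub>F \<epsilon> in at_right 0. \<forall>i\<in>I. 0 \<le> a i + \<epsilon> * b i"
    using \<open>finite I\<close> by (simp add: eventually_ball_finite)
  moreover have "\<forall>\<^sub>F \<epsilon>::real in at_right 0. 0 < \<epsilon>"
    by (simp add: eventually_at_right_less)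
  ultimately have "\<forall>\<^sub>F \<epsilon> in at_right 0. 0 < \<epsilon> \<and> (\<forall>i\<in>I. 0 \<le> a i + \<epsilon> * b i)"
    by eventually_elim simp
  then show ?thesis
    using eventually_happens trivial_limit_at_right_real by fastforce
qed

text \<open>Inside an open segment, \<open>g i\<close> is a combination of its two end values with
  positive weights; if these values are nonnegative and the combination is 0, both are 0.\<close>

lemma tight_face_of:
  fixes g :: "'i \<Rightarrow> 'a::real_vector \<Rightarrow> real"
  assumes "\<And>i. linear (g i)" "affine A" and P: "P = {v \<in> A. \<forall>i\<in>I. 0 \<le> g i v}" and "J \<subseteq> I"
  shows "{w \<in> P. \<forall>i\<in>J. g i w = 0} face_of P"
  unfolding face_of_def
proof (intro conjI ballI impI)
  note lin = linear_add[OF assms(1)] linear_scale[OF assms(1)]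
  show "{w \<in> P. \<forall>i\<in>J. g i w = 0} \<subseteq> P" by auto
  show "convex {w \<in> P. \<forall>i\<in>J. g i w = 0}"
    using affine_imp_convex[OF \<open>affine A\<close>] unfolding P convex_def by (auto simp: lin)
  fix a b x assume ab: "a \<in> P" "b \<in> P" and x: "x \<in> {w \<in> P. \<forall>i\<in>J. g i w = 0}" "x \<in> open_segment a b"
  obtain u where u: "0 < u" "u < 1" "x = (1 - u) *\<^sub>R a + u *\<^sub>R b"
    using x(2) by (auto simp: in_segment)
  have "g i a = 0 \<and> g i b = 0" if "i \<in> J" for i
  proof -
    have "(1 - u) * g i a + u * g i b = 0" using x(1) that u(3) by (simp add: lin)
    moreover have "0 \<le> g i a" "0 \<le> g i b" using ab that \<open>J \<subseteq> I\<close> by (auto simp: P)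
    ultimately show ?thesis
      using u by (simp add: add_nonneg_eq_0_iff)
  qed
  then show "a \<in> {w \<in> P. \<forall>i\<in>J. g i w = 0}" "b \<in> {w \<in> P. \<forall>i\<in>J. g i w = 0}"
    using ab by auto
qed

text \<open>Take \<open>v\<close> in \<open>F\<close> with as few tight inequalities as possible. If
  \<open>w\<close> in \<open>P\<close> is tight wherever \<open>v\<close> is, the segment from
  \<open>w\<close> to \<open>v\<close> can be prolonged inside \<open>P\<close> a little beyond
  \<open>v\<close>, and the face property then puts \<open>w\<close> into \<open>F\<close>.\<close>

lemma face_of_eq_tight:
  fixes g :: "'i \<Rightarrow> 'a::real_vector \<Rightarrow> real"
  assumes "finite I" and g: "\<And>i. linear (g i)" and "affine A"
    and P: "P = {v \<in> A. \<forall>i\<in>I. 0 \<le> g i v}" and F: "F face_of P" and "F \<noteq> {}"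
  shows "\<exists>v\<in>F. F = {w \<in> P. \<forall>i\<in>I. g i v = 0 \<longrightarrow> g i w = 0}"
proof -
  note lin = linear_add[OF g] linear_scale[OF g] linear_diff[OF g]
  have FP: "F \<subseteq> P" and "convex F" using F by (auto simp: face_of_def)
  have nonneg: "0 \<le> g i w" if "w \<in> F" "i \<in> I" for w i using FP P that by auto
  have "\<exists>v\<in>F. \<forall>i\<in>J. g i v = 0 \<longrightarrow> (\<forall>w\<in>F. g i w = 0)" if "finite J" "J \<subseteq> I" for J
    using that
  proof (induction J)
    case empty
    then show ?case using \<open>F \<noteq> {}\<close> by auto
  next
    case (insert i J)
    then obtain v where v: "v \<in> F" "\<forall>i\<in>J. g i v = 0 \<longrightarrow> (\<forall>w\<in>F. g i w = 0)" by auto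
    show ?case
    proof (cases "\<forall>w\<in>F. g i w = 0")
      case True
      then show ?thesis using v by auto
    next
      case False
      then obtain w where w: "w \<in> F" "g i w \<noteq> 0" by auto
      \<comment> \<open>As all values are nonnegative, the midpoint is tight only where both
        \<open>v\<close> and \<open>w\<close> are; it keeps what holds on \<open>J\<close> and
        settles \<open>i\<close>.\<close>
      define z where "z = (1/2) *\<^sub>R v + (1/2) *\<^sub>R w"
      have "z \<in> F"
        unfolding z_def using \<open>convex F\<close> v w by (auto intro: convexD)
      moreover have "g j z = 0 \<longleftrightarrow> g j v = 0 \<and> g j w = 0" if "j \<in> I" for j
        using nonneg[OF v(1) that] nonneg[OF w(1) that] by (auto simp: z_def lin add_nonneg_eq_0_iff)
      ultimately show ?thesis
        using v w insert.prems by (intro bexI[of _ z]) auto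
    qed
  qed
  from this[OF \<open>finite I\<close> order_refl] obtain v
    where v: "v \<in> F" "\<And>i w. i \<in> I \<Longrightarrow> g i v = 0 \<Longrightarrow> w \<in> F \<Longrightarrow> g i w = 0" by blast
  have "w \<in> F" if w: "w \<in> P" "\<forall>i\<in>I. g i v = 0 \<longrightarrow> g i w = 0" for w
  proof (cases "w = v")
    case False
    obtain \<epsilon> where \<epsilon>: "\<epsilon> > 0" "\<forall>i\<in>I. 0 \<le> g i v + \<epsilon> * (g i v - g i w)"
      using small_perturbation[OF \<open>finite I\<close>, of "\<lambda>i. g i v" "\<lambda>i. g i v - g i w"] nonneg[OF v(1)] w by auto
    \<comment> \<open>\<open>z\<close> lies beyond \<open>v\<close> as seen from \<open>w\<close>.
      Since \<open>z + \<epsilon> w = (1 + \<epsilon>) v\<close>, the point \<open>v\<close> sits at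
      parameter \<open>\<epsilon> / (1 + \<epsilon>)\<close> between \<open>z\<close> and
      \<open>w\<close>.\<close>
    define z where "z = v + \<epsilon> *\<^sub>R (v - w)"
    have "z \<in> A"
      using v(1) w(1) FP P \<open>affine A\<close> by (auto simp: z_def intro!: mem_affine_3_minus)
    then have "z \<in> P" using \<epsilon> by (simp add: P z_def lin)
    moreover have "v \<in> open_segment z w"
    proof -
      have 1: "(1 - \<epsilon> / (1 + \<epsilon>)) = 1 / (1 + \<epsilon>)" using \<epsilon>(1) by (simp add: field_simps)
      have "(1 - \<epsilon> / (1 + \<epsilon>)) *\<^sub>R z + (\<epsilon> / (1 + \<epsilon>)) *\<^sub>R w = (1 / (1 + \<epsilon>)) *\<^sub>R (z + \<epsilon> *\<^sub>R w)"
        unfolding 1 by (simp add: scaleR_add_right)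
      also have "z + \<epsilon> *\<^sub>R w = (1 + \<epsilon>) *\<^sub>R v" by (simp add: z_def algebra_simps)
      also have "(1 / (1 + \<epsilon>)) *\<^sub>R ((1 + \<epsilon>) *\<^sub>R v) = v" using \<epsilon>(1) by simp
      finally have "v = (1 - \<epsilon> / (1 + \<epsilon>)) *\<^sub>R z + (\<epsilon> / (1 + \<epsilon>)) *\<^sub>R w" by simp
      moreover have "z \<noteq> w"
      proof
        assume "z = w"
        then have "(1 + \<epsilon>) *\<^sub>R (v - w) = 0" by (simp add: z_def algebra_simps)
        with \<epsilon>(1) False show False by simp
      qed
      moreover have "0 < \<epsilon> / (1 + \<epsilon>)" "\<epsilon> / (1 + \<epsilon>) < 1" using \<epsilon>(1) by auto
      ultimately show ?thesis unfolding in_segment by blast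
    qed
    ultimately show ?thesis using F v(1) w(1) unfolding face_of_def by blast
  qed (use v in auto)
  then have "F = {w \<in> P. \<forall>i\<in>I. g i v = 0 \<longrightarrow> g i w = 0}"
    using v FP by auto
  then show ?thesis using v(1) by blast
qed

text \<open>Induction on the number of strict inequalities at \<open>x\<close>: removing a suitable
  multiple of the \<open>v\<close> from \<open>step\<close> makes one more of them tight and loosens
  none.\<close>

lemma polyhedral_cone_subset:
  fixes g :: "'i \<Rightarrow> 'a::real_vector \<Rightarrow> real"
  assumes "finite I" and g: "\<And>i. linear (g i)" and "subspace V"
    and K: "K = {v \<in> V. \<forall>i\<in>I. 0 \<le> g i v}"
    and H: "0 \<in> H" "\<And>x y. x \<in> H \<Longrightarrow> y \<in> H \<Longrightarrow> x + y \<in> H" "\<And>c x. 0 \<le> c \<Longrightarrow> x \<in> H \<Longrightarrow> c *\<^sub>R x \<in> H"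
    and step: "\<And>x. x \<in> K \<Longrightarrow> x \<noteq> 0 \<Longrightarrow>
      \<exists>v\<in>K \<inter> H. (\<exists>i\<in>I. g i v \<noteq> 0) \<and> (\<forall>i\<in>I. g i x = 0 \<longrightarrow> g i v = 0)"
  shows "K \<subseteq> H"
proof
  fix x assume "x \<in> K"
  then show "x \<in> H"
  proof (induction "card {i\<in>I. g i x \<noteq> 0}" arbitrary: x rule: less_induct)
    case less
    show ?case
    proof (cases "x = 0")
      case False
      obtain v where v: "v \<in> K" "v \<in> H" "\<exists>i\<in>I. g i v \<noteq> 0" "\<forall>i\<in>I. g i x = 0 \<longrightarrow> g i v = 0"
        using step[OF less.prems False] by blast
      define J where "J = {i\<in>I. g i v \<noteq> 0}"
      have J: "finite J" "J \<noteq> {}" using \<open>finite I\<close> v by (auto simp: J_def)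
      \<comment> \<open>The ratio test: \<open>c\<close> is the largest multiple of \<open>v\<close>
        that can be subtracted with all slacks staying nonnegative, and the index attaining the
        minimum becomes tight.\<close>
      define c where "c = Min ((\<lambda>i. g i x / g i v) ` J)"
      have pos: "0 < g i v" if "i \<in> J" for i
        using that v(1) by (auto simp: K J_def less_le)
      have nn: "0 \<le> g i x" if "i \<in> I" for i using that less.prems by (auto simp: K)
      have "c \<in> (\<lambda>i. g i x / g i v) ` J" unfolding c_def using J by (intro Min_in) auto
      then obtain i where i: "i \<in> J" "c = g i x / g i v" by auto
      have c_le: "c * g j v \<le> g j x" if "j \<in> J" for j
      proof -
        have "c \<le> g j x / g j v" unfolding c_def using J that by (intro Min_le) auto
        then show ?thesis using pos[OF that] by (simp add: field_simps)
      qed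
      have "0 \<le> c" using i pos[OF i(1)] nn[of i] by (auto simp: J_def)
      define y where "y = x - c *\<^sub>R v"
      have gy: "g j y = g j x - c * g j v" for j
        by (simp add: y_def linear_diff[OF g] linear_scale[OF g])
      have "0 \<le> g j y" if "j \<in> I" for j
        using c_le[of j] nn[OF that] that by (cases "j \<in> J") (auto simp: gy J_def)
      then have "y \<in> K"
        using less.prems v(1) \<open>subspace V\<close> by (auto simp: K y_def intro!: subspace_diff subspace_scale)
      moreover have "{i\<in>I. g i y \<noteq> 0} \<subset> {i\<in>I. g i x \<noteq> 0}"
      proof -
        have "g i y = 0" "g i x \<noteq> 0" "i \<in> I" using i pos[OF i(1)] v(4) by (auto simp: gy J_def)
        then show ?thesis using v(4) by (auto simp: gy)
      qed
      ultimately have "y \<in> H"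
        using \<open>finite I\<close> by (intro less.hyps) (auto intro: psubset_card_mono)
      then have "y + c *\<^sub>R v \<in> H" using H v \<open>0 \<le> c\<close> by blast
      then show ?thesis by (simp add: y_def)
    qed (use H in auto)
  qed
qed

subsection \<open>The cone of dominance inequalities\<close>

lemma lookup_scaleR [simp]: "Poly_Mapping.lookup (c *\<^sub>R x) k = c *\<^sub>R Poly_Mapping.lookup x k"
  by (simp add: scaleR_poly_mapping_def)

definition psum :: "(nat \<Rightarrow>\<^sub>0 real) \<Rightarrow> nat \<Rightarrow> real" where
  "psum x k = (\<Sum>i<k. Poly_Mapping.lookup x i)"

text \<open>
  \<open>brk x k\<close> is minus the second difference of the prefix sums at \<open>k > 0\<close>; truncated subtraction makes
  it \<open>0\<close> at \<open>k = 0\<close>.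
\<close>

definition brk :: "(nat \<Rightarrow>\<^sub>0 real) \<Rightarrow> nat \<Rightarrow> real" where
  "brk x k = Poly_Mapping.lookup x (k - 1) - Poly_Mapping.lookup x k"

text \<open>Dominance of the first component over the second is nonnegativity of all gaps.\<close>

definition gap :: "seq_pair \<Rightarrow> nat \<Rightarrow> real" where
  "gap v k = psum (fst v) k - psum (snd v) k"

lemma psum_0 [simp]: "psum x 0 = 0" and psum_zero [simp]: "psum 0 k = 0"
  by (simp_all add: psum_def)

lemma psum_Suc: "psum x (Suc k) = psum x k + Poly_Mapping.lookup x k"
  by (simp add: psum_def)

lemma psum_linear [simp]:
  "psum (x + y) k = psum x k + psum y k" "psum (x - y) k = psum x k - psum y k"
  "psum (c *\<^sub>R x) k = c * psum x k"
  by (simp_all add: psum_def lookup_add lookup_minus sum.distrib sum_subtractf sum_distrib_left)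

lemma brk_linear [simp]:
  "brk (x + y) k = brk x k + brk y k" "brk (x - y) k = brk x k - brk y k"
  "brk (c *\<^sub>R x) k = c * brk x k"
  by (simp_all add: brk_def lookup_add lookup_minus algebra_simps)

lemma gap_linear [simp]:
  "gap (v + w) k = gap v k + gap w k" "gap (v - w) k = gap v k - gap w k"
  "gap (c *\<^sub>R v) k = c * gap v k"
  by (simp_all add: gap_def algebra_simps)

lemma gap_0 [simp]: "gap v 0 = 0" and brk_0 [simp]: "brk x 0 = 0" and
  brk_zero [simp]: "brk 0 k = 0" and gap_zero [simp]: "gap 0 k = 0"
  by (simp_all add: gap_def brk_def)

lemma brk_eq_psum:
  "0 < k \<Longrightarrow> brk x k = 2 * psum x k - psum x (k - 1) - psum x (Suc k)"
  by (cases k) (simp_all add: brk_def psum_Suc)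

text \<open>This identity ties the three kinds of inequalities together. Where
  \<open>gap v k = 0\<close>, the second component's break is the first component's break plus the
  two neighbouring gaps, which is why it is forced there.\<close>

lemma brk_diff_eq_gap:
  "0 < k \<Longrightarrow> brk (snd v) k - brk (fst v) k = gap v (k - 1) + gap v (Suc k) - 2 * gap v k"
  by (simp add: brk_eq_psum gap_def)

lemma psum_eq_0_imp: "(\<And>k. psum x k = 0) \<Longrightarrow> x = 0"
  by (rule poly_mapping_eqI) (metis add_0 lookup_zero psum_Suc)

datatype facet = Fst_Break nat | Snd_Break nat | Gap nat

fun slack :: "facet \<Rightarrow> seq_pair \<Rightarrow> real" where
  "slack (Fst_Break k) v = brk (fst v) k"
| "slack (Snd_Break k) v = brk (snd v) k"
| "slack (Gap k) v = gap v k"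

lemma linear_slack: "linear (slack i)"
  by (cases i) (simp_all add: linear_iff)

text \<open>For \<open>r > 0\<close> the break at \<open>r\<close> of a vector in
  \<open>ambient r\<close> is its last coordinate, so the inequality at \<open>r\<close> expresses
  nonnegativity of the tuple.\<close>

definition facets :: "nat \<Rightarrow> facet set" where
  "facets r = Fst_Break ` {..r} \<union> Snd_Break ` {..r} \<union> Gap ` {..r}"

lemma finite_facets [simp]: "finite (facets r)"
  by (simp add: facets_def)

lemma in_facets [simp]:
  "Fst_Break k \<in> facets r \<longleftrightarrow> k \<le> r" "Snd_Break k \<in> facets r \<longleftrightarrow> k \<le> r" "Gap k \<in> facets r \<longleftrightarrow> k \<le> r"
  by (auto simp: facets_def)

text \<open>The equation \<open>gap v r = 0\<close> says that both tuples have the same total, the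
  common size \<open>n\<close> of the two partitions.\<close>

definition ambient :: "nat \<Rightarrow> seq_pair set" where
  "ambient r = {v. (\<forall>k\<ge>r. Poly_Mapping.lookup (fst v) k = 0 \<and> Poly_Mapping.lookup (snd v) k = 0)
     \<and> gap v r = 0}"

lemma subspace_ambient: "subspace (ambient r)"
  by (auto simp: subspace_def ambient_def lookup_add)

lemma psum_beyond:
  assumes "v \<in> ambient r" "r \<le> k"
  shows "psum (fst v) k = psum (fst v) r" "psum (snd v) k = psum (snd v) r"
  using assms(2,1) by (induction k rule: dec_induct) (auto simp: psum_Suc ambient_def)

lemma gap_beyond: "v \<in> ambient r \<Longrightarrow> r \<le> k \<Longrightarrow> gap v k = 0"
  using psum_beyond[of v r k] by (simp add: gap_def ambient_def)

lemma brk_beyond: "v \<in> ambient r \<Longrightarrow> r < k \<Longrightarrow> brk (fst v) k = 0 \<and> brk (snd v) k = 0"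
  by (simp add: brk_def ambient_def)

definition ineq_cone :: "nat \<Rightarrow> seq_pair set" where
  "ineq_cone r = {v \<in> ambient r. \<forall>i\<in>facets r. 0 \<le> slack i v}"

lemma ineq_coneI:
  "v \<in> ambient r \<Longrightarrow> (\<And>k. k \<le> r \<Longrightarrow> 0 \<le> brk (fst v) k) \<Longrightarrow> (\<And>k. k \<le> r \<Longrightarrow> 0 \<le> brk (snd v) k) \<Longrightarrow>
   (\<And>k. k \<le> r \<Longrightarrow> 0 \<le> gap v k) \<Longrightarrow> v \<in> ineq_cone r"
  by (auto simp: ineq_cone_def facets_def)

lemma ineq_coneD:
  assumes "v \<in> ineq_cone r"
  shows "v \<in> ambient r" "0 \<le> brk (fst v) k" "0 \<le> brk (snd v) k" "0 \<le> gap v k"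
proof -
  show v: "v \<in> ambient r" using assms by (simp add: ineq_cone_def)
  have *: "0 \<le> slack i v" if "i \<in> facets r" for i
    using assms that by (simp add: ineq_cone_def)
  show "0 \<le> brk (fst v) k" "0 \<le> brk (snd v) k" "0 \<le> gap v k"
    using *[of "Fst_Break k"] *[of "Snd_Break k"] *[of "Gap k"] gap_beyond[OF v, of k] brk_beyond[OF v, of k]
    by (cases "k \<le> r"; simp add: facets_def)+
qed

lemma ineq_cone_closed:
  "0 \<in> ineq_cone r" "v \<in> ineq_cone r \<Longrightarrow> w \<in> ineq_cone r \<Longrightarrow> v + w \<in> ineq_cone r"
  "0 \<le> c \<Longrightarrow> v \<in> ineq_cone r \<Longrightarrow> c *\<^sub>R v \<in> ineq_cone r"
  using subspace_ambient[of r]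
  by (auto simp: ineq_cone_def linear_add[OF linear_slack] linear_scale[OF linear_slack]
      linear_0[OF linear_slack] subspace_add subspace_scale subspace_0)

lemma convex_ineq_cone: "convex (ineq_cone r)"
  by (auto simp: convex_def intro!: ineq_cone_closed)

lemma ineq_cone_antimono:
  assumes "v \<in> ineq_cone r" "i \<le> j"
  shows "Poly_Mapping.lookup (fst v) j \<le> Poly_Mapping.lookup (fst v) i"
    "Poly_Mapping.lookup (snd v) j \<le> Poly_Mapping.lookup (snd v) i"
proof -
  have "Poly_Mapping.lookup (fst v) (Suc k) \<le> Poly_Mapping.lookup (fst v) k"
    "Poly_Mapping.lookup (snd v) (Suc k) \<le> Poly_Mapping.lookup (snd v) k" for k
    using ineq_coneD(2,3)[OF assms(1), of "Suc k"] by (simp_all add: brk_def)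
  then show "Poly_Mapping.lookup (fst v) j \<le> Poly_Mapping.lookup (fst v) i"
    "Poly_Mapping.lookup (snd v) j \<le> Poly_Mapping.lookup (snd v) i"
    using assms(2) by (auto intro: lift_Suc_antimono_le[of "Poly_Mapping.lookup _"])
qed

text \<open>A non-increasing sequence that vanishes from \<open>r\<close> on is nonnegative.\<close>

lemma ineq_cone_nonneg:
  assumes "v \<in> ineq_cone r"
  shows "0 \<le> Poly_Mapping.lookup (fst v) k" "0 \<le> Poly_Mapping.lookup (snd v) k"
  using ineq_cone_antimono[OF assms, of k "max k r"] ineq_coneD(1)[OF assms]
  by (simp_all add: ambient_def)

section \<open>Supports of the inequalities and the spaces they determine\<close>

definition fst_breaks :: "seq_pair \<Rightarrow> nat set" where "fst_breaks v = {k. brk (fst v) k \<noteq> 0}"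
definition snd_breaks :: "seq_pair \<Rightarrow> nat set" where "snd_breaks v = {k. brk (snd v) k \<noteq> 0}"
definition gaps :: "seq_pair \<Rightarrow> nat set" where "gaps v = {k. gap v k \<noteq> 0}"

lemmas support_defs = fst_breaks_def snd_breaks_def gaps_def

lemma fst_breaks_subset:
  assumes "v \<in> ambient r"
  shows "fst_breaks v \<subseteq> {1..r}"
proof
  fix k assume "k \<in> fst_breaks v"
  then have "brk (fst v) k \<noteq> 0" by (simp add: fst_breaks_def)
  then have "k \<noteq> 0" "\<not> r < k" using brk_beyond[OF assms] by (metis brk_0, metis)
  then show "k \<in> {1..r}" by simp
qed

lemma gaps_subset:
  assumes "v \<in> ambient r"
  shows "gaps v \<subseteq> {1..<r}"
proof
  fix k assume "k \<in> gaps v"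
  then have "gap v k \<noteq> 0" by (simp add: gaps_def)
  then have "k \<noteq> 0" "\<not> r \<le> k" using gap_beyond[OF assms] by (metis gap_0, metis)
  then show "k \<in> {1..<r}" by simp
qed

text \<open>A sequence without breaks is constant, and this one vanishes from \<open>r\<close>
  on.\<close>

lemma fst_eq_0_if_no_breaks:
  assumes "v \<in> ambient r" "fst_breaks v = {}"
  shows "fst v = 0"
proof (rule poly_mapping_eqI)
  fix k
  have "Poly_Mapping.lookup (fst v) n = Poly_Mapping.lookup (fst v) (Suc n)" for n
  proof -
    have "brk (fst v) (Suc n) = 0" using assms(2) by (auto simp: fst_breaks_def)
    then show ?thesis by (simp add: brk_def)
  qed
  then have "Poly_Mapping.lookup (fst v) (k + n) = Poly_Mapping.lookup (fst v) k" for n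
    by (induction n) auto
  from this[of r] show "Poly_Mapping.lookup (fst v) k = Poly_Mapping.lookup 0 k"
    using assms(1) by (simp add: ambient_def)
qed

text \<open>This will be the linear span of the face with pattern \<open>(L, D, N)\<close>. Breaks
  of the second component are restricted only inside \<open>D\<close>, as elsewhere they depend on
  the other data.\<close>

definition face_space :: "nat \<Rightarrow> nat set \<Rightarrow> nat set \<Rightarrow> nat set \<Rightarrow> seq_pair set" where
  "face_space r L D N =
     {v \<in> ambient r. fst_breaks v \<subseteq> L \<and> gaps v \<subseteq> D \<and> snd_breaks v \<inter> D \<subseteq> N}"

lemma face_space_iff:
  "v \<in> face_space r L D N \<longleftrightarrow> v \<in> ambient r \<and> (\<forall>k. k \<notin> L \<longrightarrow> brk (fst v) k = 0)
     \<and> (\<forall>k. k \<notin> D \<longrightarrow> gap v k = 0) \<and> (\<forall>k\<in>D. k \<notin> N \<longrightarrow> brk (snd v) k = 0)"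
  unfolding face_space_def support_defs by blast

lemma subspace_face_space: "subspace (face_space r L D N)"
  using subspace_ambient[of r] by (simp add: subspace_def face_space_iff)

text \<open>Outside \<open>gaps v\<close> the break of the second component is a sum of three terms.
  If it is nonzero at \<open>w\<close>, one term is nonzero at \<open>w\<close>, hence at
  \<open>v\<close>; there all terms are nonnegative and cannot cancel.\<close>

lemma snd_breaks_subset_of_face_space:
  assumes v: "v \<in> ineq_cone r" and w: "w \<in> face_space r (fst_breaks v) (gaps v) (snd_breaks v \<inter> gaps v)"
  shows "snd_breaks w \<subseteq> snd_breaks v"
proof
  fix k assume k: "k \<in> snd_breaks w"
  show "k \<in> snd_breaks v"
  proof (cases "k \<in> gaps v")
    case True
    then show ?thesis using k w by (auto simp: face_space_def)
  next
    case False
    have "0 < k" using k by (auto simp: snd_breaks_def intro: gr0I)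
    have gv: "gap v k = 0" and gw: "gap w k = 0" using False w by (auto simp: face_space_def gaps_def)
    have "brk (snd v) k = brk (fst v) k + gap v (k - 1) + gap v (Suc k)"
      and bw: "brk (snd w) k = brk (fst w) k + gap w (k - 1) + gap w (Suc k)"
      using brk_diff_eq_gap[OF \<open>0 < k\<close>, of v] brk_diff_eq_gap[OF \<open>0 < k\<close>, of w] gv gw by simp_all
    moreover have "brk (fst w) k \<noteq> 0 \<or> gap w (k - 1) \<noteq> 0 \<or> gap w (Suc k) \<noteq> 0"
      using bw k by (auto simp: snd_breaks_def)
    then have "brk (fst v) k \<noteq> 0 \<or> gap v (k - 1) \<noteq> 0 \<or> gap v (Suc k) \<noteq> 0"
      using w by (auto simp: face_space_def support_defs)
    moreover note ineq_coneD(2)[OF v, of k] ineq_coneD(4)[OF v, of "k - 1"] ineq_coneD(4)[OF v, of "Suc k"]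
    ultimately show ?thesis by (auto simp: snd_breaks_def add_nonneg_eq_0_iff)
  qed
qed

section \<open>Vectors spanning the extreme rays\<close>

definition omega :: "nat \<Rightarrow> (nat \<Rightarrow>\<^sub>0 real)" where
  "omega l = Poly_Mapping.nth (replicate l 1)"

lemma lookup_omega [simp]: "Poly_Mapping.lookup (omega l) i = (if i < l then 1 else 0)"
  by (simp add: omega_def nth_default_def)

lemma psum_omega [simp]: "psum (omega l) k = real (min k l)"
  by (induction k) (auto simp: psum_Suc)

text \<open>The fundamental weights \<open>omega l\<close> with \<open>l > 0\<close> are dual to the
  breaks.\<close>

lemma brk_omega [simp]: "brk (omega l) k = (if k = l \<and> 0 < k then 1 else 0)"
  by (cases k) (auto simp: brk_def)

text \<open>
  The vectors spanning the extreme rays: in \<open>tri p l q\<close> the prefix sums of the second component are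
  those of the first, with the break at \<open>l\<close> replaced by the chord from \<open>p\<close> to \<open>q\<close>.
\<close>

definition diag :: "nat \<Rightarrow> seq_pair" where
  "diag l = (omega l, omega l)"

definition tri :: "nat \<Rightarrow> nat \<Rightarrow> nat \<Rightarrow> seq_pair" where
  "tri p l q = (omega l,
     (real (q - l) / real (q - p)) *\<^sub>R omega p + (real (l - p) / real (q - p)) *\<^sub>R omega q)"

lemma diag_props:
  assumes "1 \<le> l" "l \<le> r"
  shows "diag l \<in> ineq_cone r" "fst_breaks (diag l) = {l}" "snd_breaks (diag l) = {l}"
    "gaps (diag l) = {}"
  using assms
  by (auto simp: diag_def support_defs gap_def ambient_def intro!: ineq_coneI)

text \<open>The graph of the gap is a tent over the interval from \<open>p\<close> to
  \<open>q\<close> with its apex at \<open>l\<close>. The case distinction is done after multiplying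
  by \<open>q - p\<close>.\<close>

lemma gap_tri:
  assumes "p < l" "l < q"
  shows "gap (tri p l q) k =
    (if k \<le> p \<or> q \<le> k then 0
     else if k \<le> l then real (k - p) * real (q - l) / real (q - p)
     else real (l - p) * real (q - k) / real (q - p))"
proof -
  have "gap (tri p l q) k = real (min k l)
    - (real (q - l) / real (q - p) * real (min k p) + real (l - p) / real (q - p) * real (min k q))"
    by (simp only: gap_def tri_def fst_conv snd_conv psum_linear psum_omega)
  then have "real (q - p) * gap (tri p l q) k = real (q - p) * real (min k l)
    - (real (q - l) * real (min k p) + real (l - p) * real (min k q))"
    using assms by (simp add: right_diff_distrib distrib_left del: of_nat_diff of_nat_min)
  also have "\<dots> = (if k \<le> p \<or> q \<le> k then 0
     else if k \<le> l then real (k - p) * real (q - l)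
     else real (l - p) * real (q - k))"
    using assms by (auto simp: min_def of_nat_diff algebra_simps)
  finally show ?thesis
    using assms by (auto simp: field_simps split: if_splits)
qed

text \<open>\<open>p = 0\<close> is allowed; the chord then starts at the origin, where there is no
  break, hence the \<open>- {0}\<close>.\<close>

lemma tri_props:
  assumes "p < l" "l < q" "q \<le> r"
  shows "tri p l q \<in> ineq_cone r" "fst_breaks (tri p l q) = {l}" "snd_breaks (tri p l q) = {p, q} - {0}"
    "gaps (tri p l q) = {p<..<q}"
proof -
  show "fst_breaks (tri p l q) = {l}" "snd_breaks (tri p l q) = {p, q} - {0}"
    using assms by (auto simp: tri_def support_defs)
  show "gaps (tri p l q) = {p<..<q}"
    using assms by (auto simp: gaps_def gap_tri)
  show "tri p l q \<in> ineq_cone r"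
  proof (rule ineq_coneI)
    show "tri p l q \<in> ambient r"
      using assms gap_tri[of p l q r] by (auto simp: ambient_def tri_def lookup_add)
    show "0 \<le> gap (tri p l q) k" for k using assms by (simp add: gap_tri)
  qed (auto simp: tri_def)
qed

text \<open>Discrete minimum principle: a negative minimum would be attained in the interior, and at
  its leftmost position the left neighbour is strictly larger, against concavity.\<close>

lemma concave_nonneg:
  fixes h :: "nat \<Rightarrow> real"
  assumes "0 \<le> h p" "0 \<le> h q" "\<And>k. p < k \<Longrightarrow> k < q \<Longrightarrow> h (k - 1) + h (Suc k) \<le> 2 * h k"
    and "p \<le> j" "j \<le> q"
  shows "0 \<le> h j"
proof (rule ccontr)
  assume neg: "\<not> 0 \<le> h j"
  define m where "m = Min (h ` {p..q})"
  have m_le: "m \<le> h k" if "p \<le> k" "k \<le> q" for k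
    unfolding m_def using that by (intro Min_le) auto
  have "m \<in> h ` {p..q}" unfolding m_def using assms by (intro Min_in) auto
  then have ex: "\<exists>k. p \<le> k \<and> k \<le> q \<and> h k = m" by auto
  define k where "k = (LEAST k. p \<le> k \<and> k \<le> q \<and> h k = m)"
  have k: "p \<le> k" "k \<le> q" "h k = m" using LeastI_ex[OF ex] by (auto simp: k_def)
  have "m < 0" using m_le[of j] assms neg by simp
  with k assms have "p < k" "k < q" by (metis linorder_not_less order_le_less)+
  have k': "p \<le> k - 1" "k - 1 \<le> q" "p \<le> Suc k" "Suc k \<le> q" using \<open>p < k\<close> \<open>k < q\<close> by auto
  have "h (k - 1) \<noteq> m"
    using not_less_Least[of "k - 1" "\<lambda>k. p \<le> k \<and> k \<le> q \<and> h k = m"] \<open>p < k\<close> \<open>k < q\<close> by (auto simp: k_def)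
  with m_le[OF k'(1,2)] m_le[OF k'(3,4)] have "2 * m < h (k - 1) + h (Suc k)" by linarith
  with assms(3)[OF \<open>p < k\<close> \<open>k < q\<close>] k show False by simp
qed

text \<open>For \<open>D\<close> inside \<open>{1..<r}\<close> and \<open>k\<close> in
  \<open>D\<close>, the maximal interval of \<open>D\<close> around \<open>k\<close> is
  \<open>{lo D k<..<hi D k}\<close>, and both ends lie outside \<open>D\<close>.\<close>

definition lo :: "nat set \<Rightarrow> nat \<Rightarrow> nat" where "lo D k = Max {j. j < k \<and> j \<notin> D}"
definition hi :: "nat set \<Rightarrow> nat \<Rightarrow> nat" where "hi D k = (LEAST j. k < j \<and> j \<notin> D)"

lemma lo_props:
  assumes "0 \<notin> D" "k \<in> D"
  shows "lo D k < k" "lo D k \<notin> D" "\<And>j. lo D k < j \<Longrightarrow> j \<le> k \<Longrightarrow> j \<in> D"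
proof -
  have "0 < k" using assms by (metis gr0I)
  then have "lo D k \<in> {j. j < k \<and> j \<notin> D}"
    unfolding lo_def using assms by (intro Max_in) auto
  then show "lo D k < k" "lo D k \<notin> D" by auto
  fix j assume "lo D k < j" "j \<le> k"
  show "j \<in> D"
  proof (rule ccontr)
    assume "j \<notin> D"
    then have "j \<le> lo D k"
      unfolding lo_def using \<open>j \<le> k\<close> assms by (intro Max_ge) (auto simp: le_less)
    with \<open>lo D k < j\<close> show False by simp
  qed
qed

lemma hi_props:
  assumes "D \<subseteq> {..<r}" "k \<in> D"
  shows "k < hi D k" "hi D k \<notin> D" "hi D k \<le> r" "\<And>j. k \<le> j \<Longrightarrow> j < hi D k \<Longrightarrow> j \<in> D"
proof -
  have r: "k < r \<and> r \<notin> D" using assms by auto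
  then show "k < hi D k" "hi D k \<notin> D"
    unfolding hi_def using LeastI[of "\<lambda>j. k < j \<and> j \<notin> D", OF r] by auto
  show "hi D k \<le> r" unfolding hi_def using r by (rule Least_le)
  show "j \<in> D" if "k \<le> j" "j < hi D k" for j
    using that assms not_less_Least[of j "\<lambda>j. k < j \<and> j \<notin> D"] by (auto simp: hi_def le_less)
qed

text \<open>For \<open>l\<close> in \<open>D\<close> the triangle spans the whole maximal interval
  around \<open>l\<close>, so the second component breaks only outside \<open>D\<close>. The chord
  thus realises the break \<open>l\<close> without adding to \<open>N\<close>.\<close>

definition chord :: "nat set \<Rightarrow> nat \<Rightarrow> seq_pair" where
  "chord D l = (if l \<in> D then tri (lo D l) l (hi D l) else diag l)"

lemma chord_props:
  assumes "D \<subseteq> {1..<r}" "1 \<le> l" "l \<le> r"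
  shows "chord D l \<in> ineq_cone r" "fst_breaks (chord D l) = {l}" "snd_breaks (chord D l) \<inter> D = {}"
    "gaps (chord D l) \<subseteq> D" "fst (chord D l) = omega l"
proof -
  have D: "0 \<notin> D" "D \<subseteq> {..<r}" using assms by auto
  show "fst (chord D l) = omega l" by (simp add: chord_def tri_def diag_def)
  have "chord D l \<in> ineq_cone r \<and> fst_breaks (chord D l) = {l} \<and> snd_breaks (chord D l) \<inter> D = {} \<and>
    gaps (chord D l) \<subseteq> D"
  proof (cases "l \<in> D")
    case True
    note lo = lo_props[OF D(1) True] and hi = hi_props[OF D(2) True]
    have "{lo D l<..<hi D l} \<subseteq> D"
      using lo(3) hi(4) by (metis greaterThanLessThan_iff linorder_le_cases subsetI)
    with tri_props[OF lo(1) hi(1,3)] lo(2) hi(2) True show ?thesis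
      by (auto simp: chord_def)
  next
    case False
    with diag_props[OF assms(2,3)] show ?thesis by (simp add: chord_def)
  qed
  then show "chord D l \<in> ineq_cone r" "fst_breaks (chord D l) = {l}" "snd_breaks (chord D l) \<inter> D = {}"
    "gaps (chord D l) \<subseteq> D" by auto
qed

lemma chord_in_face_space:
  assumes "D \<subseteq> {1..<r}" "L \<subseteq> {1..r}" "l \<in> L"
  shows "chord D l \<in> face_space r L D N"
proof -
  have "1 \<le> l" "l \<le> r" using assms by auto
  from chord_props[OF assms(1) this] ineq_coneD(1)[of "chord D l" r] assms(3) show ?thesis
    by (auto simp: face_space_def)
qed

lemma slack_eq_0_of_face_space:
  assumes v: "v \<in> ineq_cone r" and w: "w \<in> face_space r (fst_breaks v) (gaps v) (snd_breaks v \<inter> gaps v)"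
    and "slack i v = 0"
  shows "slack i w = 0"
proof -
  have "fst_breaks w \<subseteq> fst_breaks v" "gaps w \<subseteq> gaps v" "snd_breaks w \<subseteq> snd_breaks v"
    using w snd_breaks_subset_of_face_space[OF v w] by (auto simp: face_space_def)
  with assms(3) show ?thesis by (cases i) (auto simp: support_defs)
qed

subsection \<open>Faces and patterns\<close>

text \<open>If \<open>n\<close> is the last element of a maximal interval of \<open>D\<close>, this
  says that the interval meets \<open>L\<close>; for another \<open>n\<close> in \<open>D\<close>,
  it says so of the part up to \<open>n\<close>. The scan from left to right uses the second
  reading.\<close>

definition reach :: "nat set \<Rightarrow> nat set \<Rightarrow> nat \<Rightarrow> bool" where
  "reach L D n \<longleftrightarrow> (\<exists>l\<in>L. l \<le> n \<and> {l..n} \<subseteq> D)"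

text \<open>The last condition says that every maximal interval of \<open>D\<close> meets \<open>L\<close>.\<close>

definition patterns :: "nat \<Rightarrow> (nat set \<times> nat set \<times> nat set) set" where
  "patterns r = {(L, D, N). L \<subseteq> {1..r} \<and> D \<subseteq> {1..<r} \<and> N \<subseteq> D \<and>
     (\<forall>n\<in>D. Suc n \<notin> D \<longrightarrow> reach L D n)}"

text \<open>If an interval of positive gaps met no break of the first component, the gap would be
  convex on it and 0 at both ends, hence nowhere positive.\<close>

lemma pattern_of_point:
  assumes v: "v \<in> ineq_cone r"
  shows "(fst_breaks v, gaps v, snd_breaks v \<inter> gaps v) \<in> patterns r"
proof -
  note amb = ineq_coneD(1)[OF v]
  have "reach (fst_breaks v) (gaps v) n" if n: "n \<in> gaps v" "Suc n \<notin> gaps v" for n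
  proof (rule ccontr)
    assume no: "\<not> reach (fst_breaks v) (gaps v) n"
    have "0 \<notin> gaps v" using gaps_subset[OF amb] by auto
    define p where "p = lo (gaps v) n"
    note lo = lo_props[OF \<open>0 \<notin> gaps v\<close> n(1), folded p_def]
    have "0 \<le> - gap v n"
    proof (rule concave_nonneg[where h = "\<lambda>k. - gap v k" and p = p and q = "Suc n"])
      show "0 \<le> - gap v p" "0 \<le> - gap v (Suc n)" using lo(2) n(2) by (auto simp: gaps_def)
      show "p \<le> n" "n \<le> Suc n" using lo(1) by auto
      fix k assume k: "p < k" "k < Suc n"
      have "{k..n} \<subseteq> gaps v" using lo(3) k by auto
      with no k have "brk (fst v) k = 0" unfolding reach_def fst_breaks_def by (metis (mono_tags) less_Suc_eq_le mem_Collect_eq)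
      then show "- gap v (k - 1) + - gap v (Suc k) \<le> 2 * - gap v k"
        using brk_diff_eq_gap[of k v] ineq_coneD(3)[OF v, of k] k by simp
    qed
    with ineq_coneD(4)[OF v, of n] n(1) show False by (simp add: gaps_def)
  qed
  then show ?thesis
    using fst_breaks_subset[OF amb] gaps_subset[OF amb] by (auto simp: patterns_def)
qed

lemma pattern_run_meets:
  assumes "(L, D, N) \<in> patterns r" and k: "k \<in> D"
  shows "\<exists>l\<in>L. l \<in> D \<and> lo D l < k \<and> k < hi D l"
proof -
  have D: "D \<subseteq> {..<r}" "0 \<notin> D" using assms by (auto simp: patterns_def)
  note hi = hi_props[OF D(1) k]
  \<comment> \<open>The last element of the interval around \<open>k\<close>, where the pattern
    condition supplies an \<open>l\<close>; this \<open>l\<close> must then belong to the same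
    interval.\<close>
  define n where "n = hi D k - 1"
  have n: "Suc n = hi D k" "k \<le> n" using hi(1) by (auto simp: n_def)
  have "n \<in> D" using hi(4)[of n] n by auto
  moreover have "Suc n \<notin> D" using hi(2) n by simp
  ultimately obtain l where l: "l \<in> L" "l \<le> n" "{l..n} \<subseteq> D"
    using assms(1) unfolding patterns_def reach_def by blast
  have "l \<in> D" using l by auto
  note lol = lo_props[OF D(2) this] and hil = hi_props[OF D(1) this]
  have "j \<in> D" if "k \<le> j" "j \<le> n" for j using hi(4)[of j] that n by auto
  have "lo D l < k"
  proof (rule ccontr)
    assume "\<not> lo D l < k"
    then have "lo D l \<in> D" using lol(1) l(2) \<open>\<And>j. k \<le> j \<Longrightarrow> j \<le> n \<Longrightarrow> j \<in> D\<close> by auto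
    with lol(2) show False ..
  qed
  moreover have "k < hi D l"
  proof (rule ccontr)
    assume "\<not> k < hi D l"
    then have "hi D l \<in> D" using hil(1) l(3) n(2) by auto
    with hil(2) show False ..
  qed
  ultimately show ?thesis using l(1) \<open>l \<in> D\<close> by blast
qed

text \<open>For each slack that has to be nonzero there is a vector of \<open>C\<close> on which it
  is. Their sum works for all of them, because slacks are nonnegative on \<open>C\<close> and cannot
  cancel.\<close>

lemma pattern_interior_point:
  assumes pat: "(L, D, N) \<in> patterns r"
  obtains v where "v \<in> ineq_cone r" "fst_breaks v = L" "gaps v = D" "snd_breaks v \<inter> D = N"
proof -
  have L: "L \<subseteq> {1..r}" and D: "D \<subseteq> {1..<r}" and N: "N \<subseteq> D" using pat by (auto simp: patterns_def)
  have D': "0 \<notin> D" "D \<subseteq> {..<r}" using D by auto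
  define C where "C = ineq_cone r \<inter> face_space r L D N"
  have C_add: "v + w \<in> C" if "v \<in> C" "w \<in> C" for v w
    using that subspace_face_space by (auto simp: C_def intro: ineq_cone_closed subspace_add)
  have C_0: "0 \<in> C" using subspace_face_space by (auto simp: C_def intro: ineq_cone_closed subspace_0)
  have slack_nonneg: "0 \<le> slack i v" if "v \<in> C" for i v
    using that ineq_coneD[of v r] by (cases i) (auto simp: C_def)
  have chord_C: "chord D l \<in> C" if "l \<in> L" for l
    using that chord_in_face_space[OF D L] chord_props(1)[OF D] L by (force simp: C_def)
  define J where "J = Fst_Break ` L \<union> Gap ` D \<union> Snd_Break ` N"
  have attained: "\<exists>u\<in>C. slack i u \<noteq> 0" if "i \<in> J" for i
    using that unfolding J_def
  proof (elim UnE imageE)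
    fix l assume l: "i = Fst_Break l" "l \<in> L"
    then have "l \<in> fst_breaks (chord D l)" using chord_props(2)[OF D, of l] L by auto
    then show ?thesis using chord_C[OF l(2)] l by (auto simp: fst_breaks_def)
  next
    fix k assume k: "i = Gap k" "k \<in> D"
    obtain l where l: "l \<in> L" "l \<in> D" "lo D l < k" "k < hi D l"
      using pattern_run_meets[OF pat k(2)] by blast
    note lo = lo_props[OF D'(1) l(2)] and hi = hi_props[OF D'(2) l(2)]
    have "k \<in> gaps (chord D l)"
      using tri_props(4)[OF lo(1) hi(1,3)] l by (simp add: chord_def)
    then have "slack i (chord D l) \<noteq> 0" using k by (simp add: gaps_def)
    then show ?thesis using chord_C[OF l(1)] by blast
  next
    fix n assume n: "i = Snd_Break n" "n \<in> N"
    obtain l where l: "l \<in> L" "l \<in> D" "lo D l < n" "n < hi D l"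
      using pattern_run_meets[OF pat] n N by blast
    note lo = lo_props[OF D'(1) l(2)] and hi = hi_props[OF D'(2) l(2)]
    have run: "{lo D l<..<hi D l} \<subseteq> D"
      using lo(3) hi(4) by (metis greaterThanLessThan_iff linorder_le_cases subsetI)
    have n0: "0 < n" using l by auto
    \<comment> \<open>A vector whose second component breaks at \<open>n\<close> and nowhere else in
      \<open>D\<close>: a triangle with one corner at \<open>n\<close> and the other at an end of
      the interval, outside \<open>D\<close>, or the diagonal vector if
      \<open>n = l\<close>.\<close>
    consider "n < l" | "n = l" | "l < n" by linarith
    then have "\<exists>u\<in>ineq_cone r. fst_breaks u = {l} \<and> gaps u \<subseteq> D \<and> snd_breaks u \<inter> D \<subseteq> {n} \<and> n \<in> snd_breaks u"
    proof cases
      case 1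
      have "{n<..<hi D l} \<subseteq> D" using run l(3) by auto
      with tri_props[OF 1 hi(1,3)] hi(2) n0 show ?thesis
        by (intro bexI[of _ "tri n l (hi D l)"]) auto
    next
      case 2
      have "1 \<le> l" "l \<le> r" using l(1) L by auto
      from diag_props[OF this] 2 show ?thesis by (intro bexI[of _ "diag l"]) auto
    next
      case 3
      have "{lo D l<..<n} \<subseteq> D" using run l(4) by auto
      moreover have "n \<le> r" using hi(3) l(4) by simp
      ultimately show ?thesis
        using tri_props[OF lo(1) 3, of r] lo(2) n0 by (intro bexI[of _ "tri (lo D l) l n"]) auto
    qed
    then obtain u where u: "u \<in> ineq_cone r" "fst_breaks u = {l}" "gaps u \<subseteq> D"
      "snd_breaks u \<inter> D \<subseteq> {n}" "n \<in> snd_breaks u" by blast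
    then have "u \<in> C" using ineq_coneD(1)[of u r] n l by (auto simp: C_def face_space_def)
    with u show ?thesis using n by (auto simp: snd_breaks_def)
  qed
  have "finite J"
    using finite_subset[OF L] finite_subset[OF D] finite_subset[OF N] by (auto simp: J_def)
  from this attained have "\<exists>v\<in>C. \<forall>i\<in>J. slack i v \<noteq> 0"
  proof (induction J rule: finite_induct)
    case (insert i J)
    then obtain u v where uv: "u \<in> C" "slack i u \<noteq> 0" "v \<in> C" "\<forall>i\<in>J. slack i v \<noteq> 0" by force
    have "\<forall>j\<in>insert i J. slack j (u + v) \<noteq> 0"
      using uv slack_nonneg[OF uv(1)] slack_nonneg[OF uv(3)]
      by (auto simp: linear_add[OF linear_slack] add_nonneg_eq_0_iff)
    with C_add[OF uv(1,3)] show ?case by blast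
  qed (use C_0 in blast)
  then obtain v where v: "v \<in> C" "\<And>i. i \<in> J \<Longrightarrow> slack i v \<noteq> 0" by blast
  have "fst_breaks v = L" "gaps v = D" "snd_breaks v \<inter> D = N"
    using v(1) v(2)[of "Fst_Break _"] v(2)[of "Gap _"] v(2)[of "Snd_Break _"] N
    by (auto simp: C_def face_space_def support_defs J_def)
  moreover have "v \<in> ineq_cone r" using v(1) by (simp add: C_def)
  ultimately show thesis using that by blast
qed

text \<open>The chords for \<open>L\<close> and the vectors \<open>diag n - chord D n\<close> for
  \<open>N\<close> form a basis, with the breaks of the first component at \<open>L\<close> and of
  the second at \<open>N\<close> as coordinates. If all coordinates of \<open>w\<close> vanish,
  \<open>fst w = 0\<close> and the gap is affine on each interval of \<open>D\<close> with value 0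
  at the ends, so it is 0.\<close>

lemma dim_face_space:
  assumes pat: "(L, D, N) \<in> patterns r"
  shows "dim (face_space r L D N) = card L + card N"
proof -
  have L: "L \<subseteq> {1..r}" and D: "D \<subseteq> {1..<r}" and N: "N \<subseteq> D" using pat by (auto simp: patterns_def)
  have D': "0 \<notin> D" "D \<subseteq> {..<r}" using D by auto
  have fin: "finite L" "finite N"
    using finite_subset[OF L] finite_subset[OF D] finite_subset[OF N] by auto
  \<comment> \<open>In \<open>diag n - chord D n\<close> the first components cancel, and inside
    \<open>D\<close> only the break at \<open>n\<close> of the second component remains.\<close>
  define e where "e = case_sum (chord D) (\<lambda>n. diag n - chord D n)"
  define \<phi> where "\<phi> = case_sum (\<lambda>l. slack (Fst_Break l)) (\<lambda>n. slack (Snd_Break n))"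
  have brk_chord: "brk (fst (chord D l)) k = (if k = l then 1 else 0)" if "l \<in> L \<union> N" for k l
    using chord_props(5)[OF D, of l] that L N D by auto
  have brk_chord': "brk (snd (chord D l)) k = 0" if "l \<in> L \<union> N" "k \<in> D" for k l
  proof -
    have "1 \<le> l" "l \<le> r" using that L N D by auto
    from chord_props(3)[OF D this] that(2) show ?thesis by (auto simp: snd_breaks_def)
  qed
  have "dim (face_space r L D N) = card (L <+> N)"
  proof (rule dim_dual_basis[where e = e and \<phi> = \<phi>])
    show "finite (L <+> N)" using fin by simp
    show "subspace (face_space r L D N)" by (rule subspace_face_space)
    show "linear (\<phi> i)" for i by (cases i) (auto simp: \<phi>_def intro: linear_slack)
    show "e i \<in> face_space r L D N" if "i \<in> L <+> N" for i
      using that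
    proof (elim PlusE)
      fix l assume "l \<in> L" "i = Inl l"
      then show ?thesis using chord_in_face_space[OF D L] by (simp add: e_def)
    next
      fix n assume n: "n \<in> N" "i = Inr n"
      have n': "1 \<le> n" "n \<le> r" using n N D by auto
      have "diag n - chord D n \<in> ambient r"
        using diag_props(1)[OF n'] chord_props(1)[OF D n'] ineq_coneD(1) subspace_ambient
        by (metis subspace_diff)
      moreover have "gap (diag n - chord D n) k = 0" if "k \<notin> D" for k
        using that chord_props(4)[OF D n'] diag_props(4)[OF n'] by (auto simp: gaps_def)
      moreover have "brk (fst (diag n - chord D n)) k = 0" for k
        using brk_chord[of n k] n n' by (auto simp: diag_def)
      moreover have "brk (snd (diag n - chord D n)) k = 0" if "k \<in> D" "k \<notin> N" for k
        using brk_chord'[of n k] n that by (auto simp: diag_def)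
      ultimately show ?thesis using n by (simp add: e_def face_space_iff)
    qed
    show "\<phi> i (e j) = (if i = j then 1 else 0)" if "i \<in> L <+> N" "j \<in> L <+> N" for i j
      using that N D brk_chord brk_chord' by (elim PlusE) (auto simp: \<phi>_def e_def diag_def)
    show "w = 0" if w: "w \<in> face_space r L D N" "\<And>i. i \<in> L <+> N \<Longrightarrow> \<phi> i w = 0" for w
    proof -
      have amb: "w \<in> ambient r" using w(1) by (simp add: face_space_def)
      have "brk (fst w) l = 0" for l
        using w(1) w(2)[of "Inl l"] by (cases "l \<in> L") (auto simp: face_space_iff \<phi>_def)
      then have "fst_breaks w = {}" by (simp add: fst_breaks_def)
      then have fst: "fst w = 0" by (rule fst_eq_0_if_no_breaks[OF amb])
      have snd: "brk (snd w) k = 0" if "k \<in> D" for k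
        using w(1) w(2)[of "Inr k"] that by (cases "k \<in> N") (auto simp: face_space_iff \<phi>_def)
      have off: "gap w k = 0" if "k \<notin> D" for k
        using w(1) that by (simp add: face_space_iff)
      have "gap w k = 0" for k
      proof (cases "k \<in> D")
        case True
        note lo = lo_props[OF D'(1) True] and hi = hi_props[OF D'(2) True]
        have eq: "gap w (Suc j) = 2 * gap w j - gap w (j - 1)" if "lo D k < j" "j < hi D k" for j
        proof -
          have "j \<in> D" using that lo(3) hi(4) by (metis linorder_le_cases)
          then show ?thesis using brk_diff_eq_gap[of j w] fst snd[of j] that by simp
        qed
        \<comment> \<open>An affine function and its negative are both concave, so the minimum
          principle applies twice.\<close>
        have "0 \<le> gap w k"
          using concave_nonneg[of "gap w" "lo D k" "hi D k" k] off lo hi eq by simp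
        moreover have "0 \<le> - gap w k"
          using concave_nonneg[of "\<lambda>k. - gap w k" "lo D k" "hi D k" k] off lo hi eq by simp
        ultimately show ?thesis by simp
      qed (rule off)
      then have "snd w = 0" using fst by (intro psum_eq_0_imp) (simp add: gap_def)
      with fst show "w = 0" by (simp add: prod_eq_iff)
    qed
  qed
  then show ?thesis using fin by (simp add: card_Plus)
qed

section \<open>Lattice points and the Kostka cone\<close>

lemma lookup_tuple_vec:
  "Poly_Mapping.lookup (tuple_vec p) i = (if i < length p then real (p ! i) else 0)"
  by (simp add: tuple_vec_def nth_default_def)

lemma psum_tuple_vec: "psum (tuple_vec p) k = real (sum_list (take k p))"
  by (induction k) (auto simp: psum_Suc lookup_tuple_vec take_Suc_conv_app_nth)

abbreviation Kostka_points :: "nat \<Rightarrow> seq_pair set" where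
  "Kostka_points r \<equiv>
     {(tuple_vec p, tuple_vec q) | p q. (\<exists>n. p \<in> Par r n \<and> q \<in> Par r n) \<and> dominates p q}"

text \<open>Tuples correspond to vectors with natural coordinates that vanish from \<open>r\<close>
  on; monotonicity, equal totals and dominance translate into breaks, \<open>ambient\<close> and
  gaps.\<close>

lemma Kostka_points_eq:
  "Kostka_points r = {v \<in> ineq_cone r.
     \<forall>i. Poly_Mapping.lookup (fst v) i \<in> \<nat> \<and> Poly_Mapping.lookup (snd v) i \<in> \<nat>}" (is "_ = ?R")
proof
  show "Kostka_points r \<subseteq> ?R"
  proof clarify
    fix p q n assume p: "p \<in> Par r n" and q: "q \<in> Par r n" and dom: "dominates p q"
    have brk: "0 \<le> brk (tuple_vec u) k" if "u \<in> Par r n" "k \<le> r" for u k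
      using that sorted_wrt_nth_less[of "(\<ge>)" u "k - 1" k]
      by (cases "k = 0") (auto simp: Par_def brk_def lookup_tuple_vec)
    have "(tuple_vec p, tuple_vec q) \<in> ineq_cone r"
    proof (rule ineq_coneI)
      show "(tuple_vec p, tuple_vec q) \<in> ambient r"
        using p q by (simp add: ambient_def lookup_tuple_vec gap_def psum_tuple_vec Par_def)
      show "0 \<le> gap (tuple_vec p, tuple_vec q) k" if "k \<le> r" for k
        using dom p that by (simp add: gap_def psum_tuple_vec dominates_def Par_def)
    qed (use brk p q in auto)
    then show "(tuple_vec p, tuple_vec q) \<in> ineq_cone r \<and>
      (\<forall>i. Poly_Mapping.lookup (fst (tuple_vec p, tuple_vec q)) i \<in> \<nat> \<and>
        Poly_Mapping.lookup (snd (tuple_vec p, tuple_vec q)) i \<in> \<nat>)"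
      by (simp add: lookup_tuple_vec)
  qed
next
  show "?R \<subseteq> Kostka_points r"
  proof clarify
    fix x y assume xy: "(x, y) \<in> ineq_cone r"
      and nat: "\<forall>i. Poly_Mapping.lookup (fst (x, y)) i \<in> \<nat> \<and> Poly_Mapping.lookup (snd (x, y)) i \<in> \<nat>"
    obtain f g where f: "\<And>i. Poly_Mapping.lookup x i = real (f i)" and g: "\<And>i. Poly_Mapping.lookup y i = real (g i)"
      using nat unfolding Nats_def by (simp add: image_iff) metis
    define p where "p = map f [0..<r]"
    define q where "q = map g [0..<r]"
    note amb = ineq_coneD(1)[OF xy]
    have x: "x = tuple_vec p" and y: "y = tuple_vec q"
      using amb by (auto intro!: poly_mapping_eqI simp: lookup_tuple_vec p_def q_def f g ambient_def)
    have len: "length p = r" "length q = r" by (simp_all add: p_def q_def)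
    have "sorted_wrt (\<ge>) p" "sorted_wrt (\<ge>) q"
      using ineq_cone_antimono[OF xy] f g by (auto simp: sorted_wrt_iff_nth_less p_def q_def)
    moreover have "gap (x, y) r = 0" using amb by (simp add: ambient_def)
    then have "sum_list p = sum_list q" using len by (simp add: gap_def x y psum_tuple_vec)
    moreover have "dominates p q"
      using ineq_coneD(4)[OF xy] by (simp add: dominates_def gap_def x y psum_tuple_vec)
    ultimately show "\<exists>p q. (x, y) = (tuple_vec p, tuple_vec q) \<and>
      (\<exists>n. p \<in> Par r n \<and> q \<in> Par r n) \<and> dominates p q"
      using len x y by (intro exI[of _ p] exI[of _ q]) (simp add: Par_def)
  qed
qed

text \<open>
  Subtracting the largest feasible multiple of an integral chord inside the face of a point makes one
  more inequality tight, so induction writes every real point as a combination of integral ones.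
\<close>

lemma Kostka_cone_eq: "Kostka_cone r = ineq_cone r"
proof
  have "Kostka_points r \<subseteq> ineq_cone r" by (subst Kostka_points_eq) auto
  then show "Kostka_cone r \<subseteq> ineq_cone r"
    unfolding Kostka_cone_def by (rule hull_minimal) (rule convex_ineq_cone)
next
  define H where "H = Kostka_cone r"
  have point: "v \<in> H" if "v \<in> ineq_cone r"
    "\<And>i. Poly_Mapping.lookup (fst v) i \<in> \<nat>" "\<And>i. Poly_Mapping.lookup (snd v) i \<in> \<nat>" for v
    unfolding H_def Kostka_cone_def
    by (rule hull_inc, subst Kostka_points_eq) (use that in auto)
  have "convex H" by (simp add: H_def Kostka_cone_def)
  have H0: "0 \<in> H" by (rule point) (auto intro: ineq_cone_closed)
  \<comment> \<open>Natural multiples of Kostka points are Kostka points, and scaling commutes with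
    taking convex hulls.\<close>
  have nat_scale: "real m *\<^sub>R v \<in> H" if "v \<in> H" for m v
  proof -
    have "(\<lambda>v. real m *\<^sub>R v) ` Kostka_points r \<subseteq> Kostka_points r"
      unfolding Kostka_points_eq
      by (intro image_subsetI) (simp add: ineq_cone_closed Nats_mult)
    then have "(\<lambda>v. real m *\<^sub>R v) ` H \<subseteq> H"
      unfolding H_def Kostka_cone_def convex_hull_scaling[symmetric] by (rule hull_mono)
    with that show ?thesis by auto
  qed
  have H_scale: "c *\<^sub>R v \<in> H" if "0 \<le> c" "v \<in> H" for c v
  proof (cases "c = 0")
    case False
    \<comment> \<open>\<open>c v\<close> lies on the segment from 0 to \<open>m v\<close> as soon as
      \<open>m\<close> is a natural number with \<open>c \<le> m\<close>.\<close>
    obtain m where m: "c \<le> real m" using real_arch_simple by blast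
    have "(1 - c / real m) *\<^sub>R 0 + (c / real m) *\<^sub>R (real m *\<^sub>R v) \<in> H"
      using \<open>convex H\<close> H0 nat_scale[OF that(2), of m] m that(1) False
      by (intro convexD) (auto simp: divide_le_eq)
    then show ?thesis using m that(1) False by simp
  qed (simp add: H0)
  have H_add: "v + w \<in> H" if "v \<in> H" "w \<in> H" for v w
  proof -
    \<comment> \<open>A sum is the midpoint of the doubled vectors.\<close>
    have "(1/2) *\<^sub>R (2 *\<^sub>R v) + (1/2) *\<^sub>R (2 *\<^sub>R w) \<in> H"
      using that by (intro convexD[OF \<open>convex H\<close>] H_scale) auto
    then show ?thesis by simp
  qed
  have "ineq_cone r \<subseteq> H"
  proof (rule polyhedral_cone_subset[OF finite_facets linear_slack subspace_ambient ineq_cone_def H0 H_add H_scale])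
    fix v assume v: "v \<in> ineq_cone r" "v \<noteq> 0"
    note amb = ineq_coneD(1)[OF v(1)]
    \<comment> \<open>Without breaks the first component is 0, and dominance bounds the nonnegative
      prefix sums of the second by 0.\<close>
    have "fst_breaks v \<noteq> {}"
    proof
      assume "fst_breaks v = {}"
      then have fst: "fst v = 0" by (rule fst_eq_0_if_no_breaks[OF amb])
      have "psum (snd v) k = 0" for k
      proof (rule antisym)
        show "psum (snd v) k \<le> 0" using ineq_coneD(4)[OF v(1), of k] by (simp add: gap_def fst)
        show "0 \<le> psum (snd v) k"
          unfolding psum_def using ineq_cone_nonneg(2)[OF v(1)] by (intro sum_nonneg) auto
      qed
      then have "snd v = 0" by (rule psum_eq_0_imp)
      with fst v(2) show False by (simp add: prod_eq_iff)
    qed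
    then obtain l where l: "l \<in> fst_breaks v" by blast
    let ?D = "gaps v"
    let ?c = "chord ?D l"
    have D: "?D \<subseteq> {1..<r}" using gaps_subset[OF amb] .
    have l': "1 \<le> l" "l \<le> r" using l fst_breaks_subset[OF amb] by auto
    note c = chord_props[OF D l']
    have "?c \<in> face_space r (fst_breaks v) ?D (snd_breaks v \<inter> ?D)"
      using chord_in_face_space[OF D fst_breaks_subset[OF amb] l] .
    then have tight: "\<forall>i\<in>facets r. slack i v = 0 \<longrightarrow> slack i ?c = 0"
      using slack_eq_0_of_face_space[OF v(1)] by blast
    have "Fst_Break l \<in> facets r" "slack (Fst_Break l) ?c \<noteq> 0"
      using c(2) l' by (auto simp: facets_def fst_breaks_def)
    moreover have "?c \<in> H"
    proof (cases "l \<in> ?D")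
      case False
      then show ?thesis using c(1) by (intro point) (auto simp: chord_def diag_def)
    next
      case True
      have "0 \<notin> ?D" "?D \<subseteq> {..<r}" using D by auto
      then have pq: "lo ?D l < l" "l < hi ?D l" using lo_props(1) hi_props(1) True by blast+
      define p q where "p = lo ?D l" and "q = hi ?D l"
      have pq: "p < l" "l < q" using pq by (simp_all add: p_def q_def)
      \<comment> \<open>The factor \<open>q - p\<close> clears the denominators of
        \<open>tri p l q\<close>, so \<open>u\<close> is a lattice point.\<close>
      define u where "u = real (q - p) *\<^sub>R ?c"
      have u: "u = (real (q - p) *\<^sub>R omega l, real (q - l) *\<^sub>R omega p + real (l - p) *\<^sub>R omega q)"
        using True pq by (simp add: u_def chord_def tri_def p_def[symmetric] q_def[symmetric] scaleR_add_right del: of_nat_diff)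
      have "u \<in> H"
      proof (rule point)
        show "u \<in> ineq_cone r" using c(1) by (simp add: u_def ineq_cone_closed del: of_nat_diff)
        show "Poly_Mapping.lookup (fst u) i \<in> \<nat>" "Poly_Mapping.lookup (snd u) i \<in> \<nat>" for i
          by (auto simp: u lookup_add simp del: of_nat_diff)
      qed
      then have "(1 / real (q - p)) *\<^sub>R u \<in> H" by (intro H_scale) auto
      then show ?thesis using pq by (simp add: u_def del: of_nat_diff)
    qed
    ultimately show "\<exists>w\<in>ineq_cone r \<inter> H. (\<exists>i\<in>facets r. slack i w \<noteq> 0) \<and>
        (\<forall>i\<in>facets r. slack i v = 0 \<longrightarrow> slack i w = 0)"
      using tight c(1) by blast
  qed
  then show "ineq_cone r \<subseteq> Kostka_cone r" by (simp add: H_def)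
qed

section \<open>The polytope as a slice, and its faces\<close>

definition coord_sum :: "nat \<Rightarrow> seq_pair \<Rightarrow> real" where
  "coord_sum r v = psum (fst v) r + psum (snd v) r"

lemma linear_coord_sum: "linear (coord_sum r)"
  by (auto simp: linear_iff coord_sum_def algebra_simps)

lemma Kostka_polytope_eq: "Kostka_polytope r = {v \<in> ineq_cone r. coord_sum r v = 1}"
  by (auto simp: Kostka_polytope_def Kostka_cone_eq coord_sum_def psum_def sum.distrib)

lemma affine_slice: "affine {v \<in> ambient r. coord_sum r v = 1}"
proof -
  have "u *\<^sub>R v + u' *\<^sub>R w \<in> ambient r" if "v \<in> ambient r" "w \<in> ambient r" for u u' v w
    using that by (intro subspace_add subspace_scale subspace_ambient)
  then show ?thesis
    unfolding affine_def by (simp add: linear_add[OF linear_coord_sum] linear_scale[OF linear_coord_sum])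
qed

lemma Kostka_polytope_inequalities:
  "Kostka_polytope r = {v \<in> {v \<in> ambient r. coord_sum r v = 1}. \<forall>i\<in>facets r. 0 \<le> slack i v}"
  by (auto simp: Kostka_polytope_eq ineq_cone_def)

definition pattern_face :: "nat \<Rightarrow> nat set \<times> nat set \<times> nat set \<Rightarrow> seq_pair set" where
  "pattern_face r = (\<lambda>(L, D, N). Kostka_polytope r \<inter> face_space r L D N)"

text \<open>\<open>L\<close> is nonempty, since an element of \<open>N\<close> lies in an interval
  of \<open>D\<close> and that interval meets \<open>L\<close>. Hence the coordinate sum of the
  interior point is positive and it can be scaled to 1, which preserves supports.\<close>

lemma pattern_face_interior:
  assumes pat: "(L, D, N) \<in> patterns r" and "0 < card L + card N"
  obtains v where "v \<in> pattern_face r (L, D, N)" "fst_breaks v = L" "gaps v = D" "snd_breaks v \<inter> D = N"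
proof -
  obtain v where v: "v \<in> ineq_cone r" "fst_breaks v = L" "gaps v = D" "snd_breaks v \<inter> D = N"
    using pattern_interior_point[OF pat] .
  note amb = ineq_coneD(1)[OF v(1)]
  have "L \<noteq> {}"
    using assms(2) pattern_run_meets[OF pat] pat by (fastforce simp: patterns_def)
  have "0 < coord_sum r v"
  proof -
    obtain l where l: "l \<in> L" using \<open>L \<noteq> {}\<close> by blast
    with v(2) have "brk (fst v) l \<noteq> 0" by (auto simp: fst_breaks_def)
    with ineq_coneD(2)[OF v(1), of l] ineq_cone_nonneg[OF v(1), of l]
    have "0 < Poly_Mapping.lookup (fst v) (l - 1)" by (simp add: brk_def)
    moreover have "l - 1 < r" using l v(2) fst_breaks_subset[OF amb] by fastforce
    ultimately have "0 < psum (fst v) r"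
      unfolding psum_def using ineq_cone_nonneg(1)[OF v(1)] by (intro sum_pos2[of _ "l - 1"]) auto
    moreover have "0 \<le> psum (snd v) r"
      unfolding psum_def using ineq_cone_nonneg(2)[OF v(1)] by (intro sum_nonneg) auto
    ultimately show ?thesis by (simp add: coord_sum_def)
  qed
  define c where "c = 1 / coord_sum r v"
  have c: "0 < c" "c * coord_sum r v = 1" using \<open>0 < coord_sum r v\<close> by (auto simp: c_def)
  have supp: "fst_breaks (c *\<^sub>R v) = L" "gaps (c *\<^sub>R v) = D" "snd_breaks (c *\<^sub>R v) \<inter> D = N"
    using v c(1) by (auto simp: support_defs)
  have "c *\<^sub>R v \<in> ineq_cone r" using v(1) c(1) by (simp add: ineq_cone_closed)
  then have "c *\<^sub>R v \<in> pattern_face r (L, D, N)"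
    using c(2) supp ineq_coneD(1)[of "c *\<^sub>R v" r]
    by (simp add: pattern_face_def Kostka_polytope_eq linear_scale[OF linear_coord_sum] face_space_def)
  with supp that show thesis by blast
qed

text \<open>The face spans \<open>face_space r L D N\<close>: from an interior point
  \<open>v\<close> one can move a little in every direction of that space with coordinate sum 0.
  Passing to the slice lowers the dimension by one.\<close>

lemma has_aff_dim_pattern_face:
  assumes pat: "(L, D, N) \<in> patterns r" and pos: "0 < card L + card N"
  shows "has_aff_dim (pattern_face r (L, D, N)) d \<longleftrightarrow> card L + card N = d + 1"
proof -
  let ?F = "pattern_face r (L, D, N)" and ?W = "face_space r L D N"
  obtain v where v: "v \<in> ?F" "fst_breaks v = L" "gaps v = D" "snd_breaks v \<inter> D = N"
    using pattern_face_interior[OF pat pos] .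
  have vK: "v \<in> ineq_cone r" "coord_sum r v = 1" "v \<in> ?W"
    using v(1) by (auto simp: pattern_face_def Kostka_polytope_eq)
  have "w \<in> span ?F" if w: "w \<in> ?W" for w
  proof -
    define u where "u = w - coord_sum r w *\<^sub>R v"
    have u: "u \<in> ?W" "coord_sum r u = 0"
      using w vK subspace_face_space
      by (auto simp: u_def linear_diff[OF linear_coord_sum] linear_scale[OF linear_coord_sum]
          intro!: subspace_diff subspace_scale)
    have "slack i v = 0 \<longrightarrow> slack i u = 0" for i
      using slack_eq_0_of_face_space[OF vK(1), of u] u(1) v by blast
    then obtain \<epsilon> where \<epsilon>: "\<epsilon> > 0" "\<forall>i\<in>facets r. 0 \<le> slack i v + \<epsilon> * slack i u"
      using small_perturbation[of "facets r" "\<lambda>i. slack i v" "\<lambda>i. slack i u"] vK(1)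
      by (auto simp: ineq_cone_def)
    have W: "v + \<epsilon> *\<^sub>R u \<in> ?W"
      using vK u subspace_face_space by (auto intro!: subspace_add subspace_scale)
    then have "v + \<epsilon> *\<^sub>R u \<in> ?F"
      using vK u \<epsilon>
      by (simp add: pattern_face_def Kostka_polytope_eq ineq_cone_def linear_add[OF linear_coord_sum]
          linear_scale[OF linear_coord_sum] linear_add[OF linear_slack] linear_scale[OF linear_slack])
        (simp add: face_space_def)
    moreover have "w = (1 / \<epsilon>) *\<^sub>R ((v + \<epsilon> *\<^sub>R u) - v) + coord_sum r w *\<^sub>R v"
      using \<epsilon>(1) by (simp add: u_def)
    ultimately show "w \<in> span ?F"
      using v(1) by (metis span_add span_base span_diff span_scale)
  qed
  moreover have "?F \<subseteq> ?W" by (auto simp: pattern_face_def)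
  ultimately have "dim ?F = dim ?W"
    using subspace_face_space by (metis dim_span span_minimal subset_antisym subsetI)
  moreover have "has_aff_dim ?F d \<longleftrightarrow> dim ?F = d + 1"
    by (rule has_aff_dim_iff_dim[OF linear_coord_sum[of r]]) (auto simp: pattern_face_def Kostka_polytope_eq)
  ultimately show ?thesis using dim_face_space[OF pat] by simp
qed

text \<open>On the polytope the support conditions of \<open>face_space\<close> amount to the
  equations \<open>slack i v = 0\<close> for \<open>i\<close> in \<open>J\<close>; breaks and gaps
  beyond \<open>r\<close> vanish anyway.\<close>

lemma pattern_face_face_of:
  assumes "(L, D, N) \<in> patterns r"
  shows "pattern_face r (L, D, N) face_of Kostka_polytope r"
proof -
  define J where "J = Fst_Break ` ({..r} - L) \<union> Gap ` ({..r} - D) \<union> Snd_Break ` (D - N)"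
  have J: "J \<subseteq> facets r" using assms by (auto simp: J_def facets_def patterns_def)
  have "v \<in> face_space r L D N \<longleftrightarrow> (\<forall>i\<in>J. slack i v = 0)" if "v \<in> Kostka_polytope r" for v
  proof -
    have amb: "v \<in> ambient r" using that by (simp add: Kostka_polytope_inequalities)
    show ?thesis
    proof
      assume "v \<in> face_space r L D N"
      then show "\<forall>i\<in>J. slack i v = 0" by (auto simp: face_space_iff J_def)
    next
      assume *: "\<forall>i\<in>J. slack i v = 0"
      have "brk (fst v) k = 0" if "k \<notin> L" for k
        using bspec[OF *, of "Fst_Break k"] that brk_beyond[OF amb, of k]
        by (cases "k \<le> r") (simp_all add: J_def)
      moreover have "gap v k = 0" if "k \<notin> D" for k
        using bspec[OF *, of "Gap k"] that gap_beyond[OF amb, of k]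
        by (cases "k \<le> r") (simp_all add: J_def)
      moreover have "brk (snd v) k = 0" if "k \<in> D" "k \<notin> N" for k
        using bspec[OF *, of "Snd_Break k"] that by (simp add: J_def)
      ultimately show "v \<in> face_space r L D N" using amb by (simp add: face_space_iff)
    qed
  qed
  then have "pattern_face r (L, D, N) = {w \<in> Kostka_polytope r. \<forall>i\<in>J. slack i w = 0}"
    by (auto simp: pattern_face_def)
  then show ?thesis
    using tight_face_of[OF linear_slack affine_slice Kostka_polytope_inequalities J] by simp
qed

text \<open>Faces and patterns correspond: an interior point of a pattern face recovers the pattern,
  and conversely a face is fixed by the tight inequalities at one of its points, whose supports form
  a pattern.\<close>

lemma num_faces_eq_card_patterns:
  "num_faces d r = card {(L, D, N) \<in> patterns r. card L + card N = d + 1}"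
proof -
  let ?T = "{(L, D, N) \<in> patterns r. card L + card N = d + 1}"
  let ?S = "{F. F face_of Kostka_polytope r \<and> has_aff_dim F d}"
  have inj: "inj_on (pattern_face r) ?T"
  proof (rule inj_onI, clarify, goal_cases)
    case (1 L D N L' D' N')
    obtain v where v: "v \<in> pattern_face r (L, D, N)" "fst_breaks v = L" "gaps v = D" "snd_breaks v \<inter> D = N"
      using pattern_face_interior[OF 1(2)] 1(3) by auto
    obtain w where w: "w \<in> pattern_face r (L', D', N')" "fst_breaks w = L'" "gaps w = D'" "snd_breaks w \<inter> D' = N'"
      using pattern_face_interior[OF 1(4)] 1(5) by auto
    have "v \<in> face_space r L' D' N'" "w \<in> face_space r L D N"
      using v(1) w(1) 1(1) by (auto simp: pattern_face_def)
    then show ?case using v(2-) w(2-) unfolding face_space_def by blast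
  qed
  have image: "pattern_face r ` ?T = ?S"
  proof
    show "pattern_face r ` ?T \<subseteq> ?S"
      using pattern_face_face_of has_aff_dim_pattern_face by force
    show "?S \<subseteq> pattern_face r ` ?T"
    proof clarify
      fix F assume F: "F face_of Kostka_polytope r" and dim: "has_aff_dim F d"
      \<comment> \<open>For the empty face the set \<open>B\<close> would be empty, while its
        cardinality is \<open>d + 1\<close>.\<close>
      have "F \<noteq> {}"
      proof
        assume "F = {}"
        with dim obtain B :: "seq_pair set" where "affine hull B = {}" "card B = d + 1"
          by (auto simp: has_aff_dim_def)
        then show False by simp
      qed
      then obtain v where v: "v \<in> F"
        and Fv: "F = {w \<in> Kostka_polytope r. \<forall>i\<in>facets r. slack i v = 0 \<longrightarrow> slack i w = 0}"
        using face_of_eq_tight[OF finite_facets linear_slack affine_slice Kostka_polytope_inequalities F] by blast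
      have vK: "v \<in> ineq_cone r" using v Fv by (simp add: Kostka_polytope_eq)
      note amb = ineq_coneD(1)[OF vK]
      let ?W = "face_space r (fst_breaks v) (gaps v) (snd_breaks v \<inter> gaps v)"
      have pat: "(fst_breaks v, gaps v, snd_breaks v \<inter> gaps v) \<in> patterns r"
        by (rule pattern_of_point[OF vK])
      have "(\<forall>i\<in>facets r. slack i v = 0 \<longrightarrow> slack i w = 0) \<longleftrightarrow> w \<in> ?W" if "w \<in> Kostka_polytope r" for w
      proof
        assume W: "w \<in> ?W"
        then show "\<forall>i\<in>facets r. slack i v = 0 \<longrightarrow> slack i w = 0"
          using slack_eq_0_of_face_space[OF vK W] by blast
      next
        assume *: "\<forall>i\<in>facets r. slack i v = 0 \<longrightarrow> slack i w = 0"
        have ambw: "w \<in> ambient r" using that by (simp add: Kostka_polytope_inequalities)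
        have "slack i w = 0" if "slack i v = 0" for i
        proof (cases "i \<in> facets r")
          case True
          then show ?thesis using * that by blast
        next
          case False
          then show ?thesis using gap_beyond[OF ambw] brk_beyond[OF ambw]
            by (cases i) simp_all
        qed
        from this[of "Fst_Break _"] this[of "Snd_Break _"] this[of "Gap _"] show "w \<in> ?W"
          using ambw by (auto simp: face_space_def support_defs)
      qed
      then have F_eq: "F = pattern_face r (fst_breaks v, gaps v, snd_breaks v \<inter> gaps v)"
        using Fv by (auto simp: pattern_face_def)
      have "finite (fst_breaks v)" using fst_breaks_subset[OF amb] finite_subset by auto
      have "fst_breaks v \<noteq> {}"
      proof
        assume "fst_breaks v = {}"
        then have "psum (fst v) r = 0" using fst_eq_0_if_no_breaks[OF amb] by simp
        moreover have "psum (snd v) r = 0" using calculation amb by (simp add: ambient_def gap_def)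
        moreover have "coord_sum r v = 1" using v Fv by (simp add: Kostka_polytope_eq)
        ultimately show False by (simp add: coord_sum_def)
      qed
      with \<open>finite (fst_breaks v)\<close> have "0 < card (fst_breaks v)" by (simp add: card_gt_0_iff)
      then have "card (fst_breaks v) + card (snd_breaks v \<inter> gaps v) = d + 1"
        using has_aff_dim_pattern_face[OF pat] dim F_eq by simp
      with F_eq pat show "F \<in> pattern_face r ` ?T" by blast
    qed
  qed
  show ?thesis
    unfolding num_faces_def image[symmetric] by (rule card_image[OF inj])
qed

subsection \<open>Counting patterns\<close>

lemma reach_Suc: "reach L D (Suc r) \<longleftrightarrow> Suc r \<in> D \<and> (Suc r \<in> L \<or> reach L D r)"
proof
  assume "reach L D (Suc r)"
  then obtain l where l: "l \<in> L" "l \<le> Suc r" "{l..Suc r} \<subseteq> D" by (auto simp: reach_def)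
  then have "Suc r \<in> D" by auto
  moreover have "reach L D r" if "Suc r \<notin> L"
  proof -
    have "l \<le> r" using l that by (metis le_SucE)
    moreover have "{l..r} \<subseteq> D" using l(3) by auto
    ultimately show ?thesis using l(1) by (auto simp: reach_def)
  qed
  ultimately show "Suc r \<in> D \<and> (Suc r \<in> L \<or> reach L D r)" by blast
next
  assume *: "Suc r \<in> D \<and> (Suc r \<in> L \<or> reach L D r)"
  show "reach L D (Suc r)"
  proof (cases "Suc r \<in> L")
    case True
    then show ?thesis using * by (auto simp: reach_def intro!: bexI[of _ "Suc r"])
  next
    case False
    then obtain l where "l \<in> L" "l \<le> r" "{l..r} \<subseteq> D" using * by (auto simp: reach_def)
    then show ?thesis using * by (auto simp: reach_def atLeastAtMostSuc_conv intro!: bexI[of _ l])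
  qed
qed

lemma reach_mem: "reach L D n \<Longrightarrow> n \<in> D"
  by (auto simp: reach_def)

text \<open>Here \<open>D\<close> may contain \<open>r\<close>, unlike in a pattern: an interval at
  the right end may still be open.\<close>

definition words :: "nat \<Rightarrow> (nat set \<times> nat set \<times> nat set) set" where
  "words r = {(L, D, N). L \<subseteq> {1..r} \<and> D \<subseteq> {1..r} \<and> N \<subseteq> D}"

text \<open>Only intervals that end before \<open>r\<close> are tested; one containing
  \<open>r\<close> may continue at \<open>Suc r\<close>.\<close>

definition runs_ok :: "nat \<Rightarrow> nat set \<Rightarrow> nat set \<Rightarrow> bool" where
  "runs_ok r L D \<longleftrightarrow> (\<forall>n\<in>D. n < r \<and> Suc n \<notin> D \<longrightarrow> reach L D n)"

text \<open>The three automaton states after reading the positions \<open>1..r\<close>.\<close>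

definition closed_words :: "nat \<Rightarrow> (nat set \<times> nat set \<times> nat set) set" where
  "closed_words r = {(L, D, N) \<in> words r. runs_ok r L D \<and> r \<notin> D}"

definition pending_words :: "nat \<Rightarrow> (nat set \<times> nat set \<times> nat set) set" where
  "pending_words r = {(L, D, N) \<in> words r. runs_ok r L D \<and> r \<in> D \<and> \<not> reach L D r}"

definition served_words :: "nat \<Rightarrow> (nat set \<times> nat set \<times> nat set) set" where
  "served_words r = {(L, D, N) \<in> words r. runs_ok r L D \<and> reach L D r}"

lemmas state_defs = closed_words_def pending_words_def served_words_def

lemma state_subsets: "closed_words r \<subseteq> words r" "pending_words r \<subseteq> words r" "served_words r \<subseteq> words r"
  by (auto simp: state_defs)

text \<open>If \<open>r\<close> is not in \<open>D\<close>, no interval is open at the end, so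
  \<open>runs_ok\<close> tests all of them.\<close>

lemma patterns_eq_closed_words: "patterns r = closed_words r"
proof -
  have "D \<subseteq> {1..<r} \<longleftrightarrow> D \<subseteq> {1..r} \<and> r \<notin> D" for D :: "nat set"
    by (auto simp: subset_iff) (metis le_neq_implies_less)
  moreover have "(\<forall>n\<in>D. Suc n \<notin> D \<longrightarrow> reach L D n) \<longleftrightarrow> runs_ok r L D" if "D \<subseteq> {1..<r}" for L D
    using that by (auto simp: runs_ok_def)
  ultimately have "(L, D, N) \<in> patterns r \<longleftrightarrow> (L, D, N) \<in> closed_words r" for L D N
    unfolding patterns_def state_defs words_def mem_Collect_eq case_prod_conv by metis
  then show ?thesis by auto
qed

section \<open>Transitions of the automaton\<close>

definition ins :: "bool \<Rightarrow> nat \<Rightarrow> nat set \<Rightarrow> nat set" where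
  "ins b r X = (if b then insert (Suc r) X else X)"

definition extend :: "nat \<Rightarrow> bool \<times> bool \<times> bool \<Rightarrow> nat set \<times> nat set \<times> nat set \<Rightarrow> nat set \<times> nat set \<times> nat set" where
  "extend r = (\<lambda>(l, d, n) (L, D, N). (ins l r L, ins d r D, ins n r N))"

lemma mem_ins: "X \<subseteq> {1..r} \<Longrightarrow> Suc r \<in> ins b r X \<longleftrightarrow> b" "m \<le> r \<Longrightarrow> m \<in> ins b r X \<longleftrightarrow> m \<in> X"
  by (auto simp: ins_def)

lemma card_ins: "X \<subseteq> {1..r} \<Longrightarrow> card (ins b r X) = card X + of_bool b"
  by (auto simp: ins_def intro!: card_insert_disjoint finite_subset[of X "{1..r}"])

lemma ins_restrict: "X \<subseteq> {1..Suc r} \<Longrightarrow> X = ins (Suc r \<in> X) r (X \<inter> {1..r})"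
  by (auto simp: ins_def le_Suc_eq)

lemma ins_inject: "X \<subseteq> {1..r} \<Longrightarrow> Y \<subseteq> {1..r} \<Longrightarrow> ins b r X = ins c r Y \<longleftrightarrow> b = c \<and> X = Y"
proof -
  assume "X \<subseteq> {1..r}" "Y \<subseteq> {1..r}"
  then have "Suc r \<notin> X" "Suc r \<notin> Y" by auto
  then show ?thesis by (auto simp: ins_def insert_ident)
qed

lemma ins_subset: "X \<subseteq> {1..r} \<Longrightarrow> ins b r X \<subseteq> {1..Suc r}"
  by (auto simp: ins_def)

lemma ins_mono: "X \<subseteq> {1..r} \<Longrightarrow> Y \<subseteq> {1..r} \<Longrightarrow> ins b r X \<subseteq> ins c r Y \<longleftrightarrow> X \<subseteq> Y \<and> (b \<longrightarrow> c)"
proof -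
  assume "X \<subseteq> {1..r}" "Y \<subseteq> {1..r}"
  then have "Suc r \<notin> X" "Suc r \<notin> Y" by auto
  then show ?thesis by (auto simp: ins_def)
qed

lemma reach_ins: "n \<le> r \<Longrightarrow> reach (ins l r L) (ins d r D) n \<longleftrightarrow> reach L D n"
proof -
  assume n: "n \<le> r"
  have "{k..n} \<subseteq> ins d r D \<longleftrightarrow> {k..n} \<subseteq> D" for k
    using n by (auto simp: ins_def)
  then show ?thesis using n by (auto simp: reach_def ins_def)
qed

text \<open>The only new test is at \<open>n = r\<close>, where an interval closes if
  \<open>Suc r\<close> is left out of \<open>D\<close>.\<close>

lemma runs_ok_ins:
  assumes "D \<subseteq> {1..r}"
  shows "runs_ok (Suc r) (ins l r L) (ins d r D) \<longleftrightarrow> runs_ok r L D \<and> (r \<in> D \<and> \<not> d \<longrightarrow> reach L D r)"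
proof -
  have "runs_ok (Suc r) (ins l r L) (ins d r D) \<longleftrightarrow>
    (\<forall>n\<in>D. n \<le> r \<and> Suc n \<notin> ins d r D \<longrightarrow> reach L D n)"
    unfolding runs_ok_def
    by (metis less_Suc_eq_le mem_ins(2) reach_ins)
  also have "\<dots> \<longleftrightarrow> runs_ok r L D \<and> (r \<in> D \<and> \<not> d \<longrightarrow> reach L D r)"
    unfolding runs_ok_def
    by (metis Suc_leI assms le_neq_implies_less less_imp_le_nat mem_ins order_refl)
  finally show ?thesis .
qed

lemma extend_in_words:
  assumes "(L, D, N) \<in> words r"
  shows "extend r (l, d, n) (L, D, N) \<in> words (Suc r) \<longleftrightarrow> (n \<longrightarrow> d)"
proof -
  have "L \<subseteq> {1..r}" "D \<subseteq> {1..r}" "N \<subseteq> {1..r}" "N \<subseteq> D" using assms by (auto simp: words_def)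
  then show ?thesis
    using ins_subset[of L r l] ins_subset[of D r d] ins_mono[of N r D n d]
    by (simp add: words_def extend_def)
qed

lemma words_Suc_cases:
  assumes "T \<in> words (Suc r)"
  obtains f T' where "T' \<in> words r" "T = extend r f T'"
proof -
  obtain L D N where T: "T = (L, D, N)" "L \<subseteq> {1..Suc r}" "D \<subseteq> {1..Suc r}" "N \<subseteq> D"
    using assms by (auto simp: words_def)
  have "T = extend r (Suc r \<in> L, Suc r \<in> D, Suc r \<in> N) (L \<inter> {1..r}, D \<inter> {1..r}, N \<inter> {1..r})"
    using ins_restrict[OF T(2)] ins_restrict[OF T(3)] ins_restrict[of N r] T by (simp add: extend_def)
  moreover have "(L \<inter> {1..r}, D \<inter> {1..r}, N \<inter> {1..r}) \<in> words r" using T by (auto simp: words_def)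
  ultimately show thesis using that by blast
qed

text \<open>The transition table: an interval opens or continues when \<open>d\<close> holds,
  becomes served as soon as \<open>l\<close> holds inside it, and may close only when
  served.\<close>

lemma extend_state:
  assumes "(L, D, N) \<in> words r"
  shows "extend r (l, d, n) (L, D, N) \<in> closed_words (Suc r) \<longleftrightarrow>
      \<not> d \<and> \<not> n \<and> (L, D, N) \<in> closed_words r \<union> served_words r"
    "extend r (l, d, n) (L, D, N) \<in> pending_words (Suc r) \<longleftrightarrow>
      d \<and> \<not> l \<and> (L, D, N) \<in> closed_words r \<union> pending_words r"
    "extend r (l, d, n) (L, D, N) \<in> served_words (Suc r) \<longleftrightarrow>
      d \<and> (if l then (L, D, N) \<in> closed_words r \<union> pending_words r \<union> served_words r else (L, D, N) \<in> served_words r)"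
proof -
  have L: "L \<subseteq> {1..r}" and D: "D \<subseteq> {1..r}" using assms by (auto simp: words_def)
  note w = extend_in_words[OF assms, of l d n]
  have e: "extend r (l, d, n) (L, D, N) = (ins l r L, ins d r D, ins n r N)" by (simp add: extend_def)
  have rs: "reach (ins l r L) (ins d r D) (Suc r) \<longleftrightarrow> d \<and> (l \<or> reach L D r)"
    by (simp add: reach_Suc mem_ins(1)[OF L] mem_ins(1)[OF D] reach_ins)
  have m: "Suc r \<in> ins d r D \<longleftrightarrow> d" by (rule mem_ins(1)[OF D])
  note rules = state_defs mem_Collect_eq case_prod_conv Un_iff e
  show "extend r (l, d, n) (L, D, N) \<in> closed_words (Suc r) \<longleftrightarrow>
      \<not> d \<and> \<not> n \<and> (L, D, N) \<in> closed_words r \<union> served_words r"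
    using w reach_mem[of L D r] assms runs_ok_ins[OF D, of l L d] m unfolding rules by blast
  show "extend r (l, d, n) (L, D, N) \<in> pending_words (Suc r) \<longleftrightarrow>
      d \<and> \<not> l \<and> (L, D, N) \<in> closed_words r \<union> pending_words r"
    using w reach_mem[of L D r] assms runs_ok_ins[OF D, of l L d] m rs unfolding rules by blast
  show "extend r (l, d, n) (L, D, N) \<in> served_words (Suc r) \<longleftrightarrow>
      d \<and> (if l then (L, D, N) \<in> closed_words r \<union> pending_words r \<union> served_words r else (L, D, N) \<in> served_words r)"
    using w reach_mem[of L D r] assms runs_ok_ins[OF D, of l L d] m rs unfolding rules by (cases l) auto
qed


lemma closed_words_Suc:
  "closed_words (Suc r) = (\<Union>f\<in>{(False, False, False), (True, False, False)}.
     extend r f ` (closed_words r \<union> served_words r))" (is "_ = ?R")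
proof
  show "closed_words (Suc r) \<subseteq> ?R"
  proof
    fix T assume T: "T \<in> closed_words (Suc r)"
    then obtain l d n L D N where *: "(L, D, N) \<in> words r" "T = extend r (l, d, n) (L, D, N)"
      using state_subsets(1) words_Suc_cases by (metis prod_cases3 subsetD)
    with T extend_state(1)[OF *(1), of l d n] show "T \<in> ?R" by (cases l) auto
  qed
  show "?R \<subseteq> closed_words (Suc r)"
    using extend_state(1) state_subsets[of r] by fastforce
qed

lemma pending_words_Suc:
  "pending_words (Suc r) = (\<Union>f\<in>{(False, True, False), (False, True, True)}.
     extend r f ` (closed_words r \<union> pending_words r))" (is "_ = ?R")
proof
  show "pending_words (Suc r) \<subseteq> ?R"
  proof
    fix T assume T: "T \<in> pending_words (Suc r)"
    then obtain l d n L D N where *: "(L, D, N) \<in> words r" "T = extend r (l, d, n) (L, D, N)"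
      using state_subsets(2) words_Suc_cases by (metis prod_cases3 subsetD)
    with T extend_state(2)[OF *(1), of l d n] show "T \<in> ?R" by (cases n) auto
  qed
  show "?R \<subseteq> pending_words (Suc r)"
    using extend_state(2) state_subsets[of r] by fastforce
qed

lemma served_words_Suc:
  "served_words (Suc r) =
     (\<Union>f\<in>{(True, True, False), (True, True, True)}.
        extend r f ` (closed_words r \<union> pending_words r \<union> served_words r))
   \<union> (\<Union>f\<in>{(False, True, False), (False, True, True)}. extend r f ` served_words r)" (is "_ = ?R")
proof
  show "served_words (Suc r) \<subseteq> ?R"
  proof
    fix T assume T: "T \<in> served_words (Suc r)"
    then obtain l d n L D N where *: "(L, D, N) \<in> words r" "T = extend r (l, d, n) (L, D, N)"
      using state_subsets(3) words_Suc_cases by (metis prod_cases3 subsetD)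
    with T extend_state(3)[OF *(1), of l d n] show "T \<in> ?R" by (cases l; cases n) auto
  qed
  show "?R \<subseteq> served_words (Suc r)"
    using extend_state(3) state_subsets[of r] by fastforce
qed

lemma finite_words: "finite (words r)"
proof (rule finite_subset)
  show "words r \<subseteq> Pow {1..r} \<times> Pow {1..r} \<times> Pow {1..r}" by (auto simp: words_def)
qed simp

section \<open>Recurrences for the counts by weight\<close>

definition weight :: "nat set \<times> nat set \<times> nat set \<Rightarrow> nat" where
  "weight = (\<lambda>(L, D, N). card L + card N)"

definition weight_count :: "(nat set \<times> nat set \<times> nat set) set \<Rightarrow> nat \<Rightarrow> int" where
  "weight_count S e = int (card {T \<in> S. weight T = e})"

text \<open>Multiplication by \<open>x\<close> of the generating function whose coefficient at
  \<open>x^e\<close> is \<open>f e\<close>.\<close>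

definition shift :: "(nat \<Rightarrow> int) \<Rightarrow> nat \<Rightarrow> int" where
  "shift f e = (case e of 0 \<Rightarrow> 0 | Suc e' \<Rightarrow> f e')"

lemma shift_simps [simp]: "shift f 0 = 0" "shift f (Suc e) = f e"
  by (simp_all add: shift_def)

lemma weight_count_Un:
  assumes "S \<subseteq> words r" "S' \<subseteq> words r" "S \<inter> S' = {}"
  shows "weight_count (S \<union> S') e = weight_count S e + weight_count S' e"
proof -
  have "{T \<in> S \<union> S'. weight T = e} = {T \<in> S. weight T = e} \<union> {T \<in> S'. weight T = e}" by auto
  moreover have "finite {T \<in> S. weight T = e}" "finite {T \<in> S'. weight T = e}"
    using assms finite_subset[OF _ finite_words[of r]] by auto
  moreover have "{T \<in> S. weight T = e} \<inter> {T \<in> S'. weight T = e} = {}" using assms(3) by auto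
  ultimately show ?thesis by (simp add: weight_count_def card_Un_disjoint)
qed

lemma extend_inject:
  assumes "S \<in> words r" "T \<in> words r"
  shows "extend r f S = extend r g T \<longleftrightarrow> f = g \<and> S = T"
proof -
  obtain L D N L' D' N' where ST: "S = (L, D, N)" "T = (L', D', N')" by (metis prod_cases3)
  obtain l d n l' d' n' where fg: "f = (l, d, n)" "g = (l', d', n')" by (metis prod_cases3)
  have sub: "L \<subseteq> {1..r}" "D \<subseteq> {1..r}" "N \<subseteq> {1..r}" "L' \<subseteq> {1..r}" "D' \<subseteq> {1..r}" "N' \<subseteq> {1..r}"
    using assms ST by (auto simp: words_def)
  show ?thesis
    unfolding ST fg extend_def
    by (auto simp: ins_inject[OF sub(1,4)] ins_inject[OF sub(2,5)] ins_inject[OF sub(3,6)])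
qed

lemma extend_images_disjoint:
  assumes "S \<subseteq> words r" "S' \<subseteq> words r" "F \<inter> G = {}"
  shows "(\<Union>f\<in>F. extend r f ` S) \<inter> (\<Union>g\<in>G. extend r g ` S') = {}"
proof (rule equals0I)
  fix T assume "T \<in> (\<Union>f\<in>F. extend r f ` S) \<inter> (\<Union>g\<in>G. extend r g ` S')"
  then obtain f g A B where *: "f \<in> F" "g \<in> G" "A \<in> S" "B \<in> S'" "extend r f A = extend r g B" by blast
  then have "f = g" using extend_inject[of A r B f g] assms(1,2) by blast
  with * assms(3) show False by blast
qed

lemma weight_extend:
  assumes "T \<in> words r"
  shows "weight (extend r (l, d, n) T) = weight T + of_bool l + of_bool n"
proof -
  obtain L D N where T: "T = (L, D, N)" by (metis prod_cases3)
  have "L \<subseteq> {1..r}" "N \<subseteq> {1..r}" using assms T by (auto simp: words_def)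
  then show ?thesis by (simp add: T extend_def weight_def card_ins)
qed

lemma card_weight_extend:
  assumes "S \<subseteq> words r"
  shows "card {T \<in> extend r f ` S. weight T = e} = card {T \<in> S. weight (extend r f T) = e}"
proof -
  have "{T \<in> extend r f ` S. weight T = e} = extend r f ` {T \<in> S. weight (extend r f T) = e}" by auto
  moreover have "inj_on (extend r f) {T \<in> S. weight (extend r f T) = e}"
  proof (rule inj_onI)
    fix T T' assume "T \<in> {T \<in> S. weight (extend r f T) = e}" "T' \<in> {T \<in> S. weight (extend r f T) = e}"
      and eq: "extend r f T = extend r f T'"
    then have "T \<in> words r" "T' \<in> words r" using assms by auto
    with eq show "T = T'" by (simp add: extend_inject)
  qed
  ultimately show ?thesis by (simp add: card_image)
qed

text \<open>Putting \<open>Suc r\<close> into \<open>L\<close> or into \<open>N\<close> costs one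
  unit of weight each; putting it into \<open>D\<close> is free.\<close>

lemma weight_count_extend:
  assumes "S \<subseteq> words r"
  shows "weight_count (extend r (False, d, False) ` S) e = weight_count S e"
    "weight_count (extend r (True, d, False) ` S) e = shift (weight_count S) e"
    "weight_count (extend r (False, d, True) ` S) e = shift (weight_count S) e"
    "weight_count (extend r (True, d, True) ` S) e = shift (shift (weight_count S)) e"
proof -
  have *: "weight_count (extend r (l, d, n) ` S) e = int (card {T \<in> S. weight T + of_bool l + of_bool n = e})" for l n
  proof -
    have "{T \<in> S. weight (extend r (l, d, n) T) = e} = {T \<in> S. weight T + of_bool l + of_bool n = e}"
      using assms weight_extend by auto
    then show ?thesis by (simp add: weight_count_def card_weight_extend[OF assms])
  qed
  show "weight_count (extend r (False, d, False) ` S) e = weight_count S e"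
    unfolding * by (simp add: weight_count_def)
  show "weight_count (extend r (True, d, False) ` S) e = shift (weight_count S) e"
    "weight_count (extend r (False, d, True) ` S) e = shift (weight_count S) e"
    unfolding * by (cases e; simp add: weight_count_def)+
  show "weight_count (extend r (True, d, True) ` S) e = shift (shift (weight_count S)) e"
    unfolding * by (auto simp: weight_count_def shift_def split: nat.split)
qed

lemma weight_count_two_extensions:
  assumes "S \<subseteq> words r" "f \<noteq> g" "f = (l, d, n)" "n \<longrightarrow> d" "g = (l', d', n')" "n' \<longrightarrow> d'"
  shows "weight_count (\<Union>h\<in>{f, g}. extend r h ` S) e = weight_count (extend r f ` S) e + weight_count (extend r g ` S) e"
    "(\<Union>h\<in>{f, g}. extend r h ` S) \<subseteq> words (Suc r)"
proof -
  have sub: "extend r f ` S \<subseteq> words (Suc r)" "extend r g ` S \<subseteq> words (Suc r)"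
    using assms extend_in_words by fastforce+
  moreover have "extend r f ` S \<inter> extend r g ` S = {}"
    using extend_images_disjoint[OF assms(1,1), of "{f}" "{g}"] assms(2) by simp
  ultimately show "weight_count (\<Union>h\<in>{f, g}. extend r h ` S) e = weight_count (extend r f ` S) e + weight_count (extend r g ` S) e"
    using weight_count_Un by simp
  show "(\<Union>h\<in>{f, g}. extend r h ` S) \<subseteq> words (Suc r)" using sub by auto
qed

definition C_count :: "nat \<Rightarrow> nat \<Rightarrow> int" where "C_count r = weight_count (closed_words r)"
definition P_count :: "nat \<Rightarrow> nat \<Rightarrow> int" where "P_count r = weight_count (pending_words r)"
definition S_count :: "nat \<Rightarrow> nat \<Rightarrow> int" where "S_count r = weight_count (served_words r)"

lemma state_disjoint:
  "closed_words r \<inter> pending_words r = {}" "closed_words r \<inter> served_words r = {}"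
  "(closed_words r \<union> pending_words r) \<inter> served_words r = {}"
  using reach_mem by (auto simp: state_defs)

lemma weight_count_unions:
  "weight_count (closed_words r \<union> served_words r) = (\<lambda>e. C_count r e + S_count r e)"
  "weight_count (closed_words r \<union> pending_words r) = (\<lambda>e. C_count r e + P_count r e)"
  "weight_count (closed_words r \<union> pending_words r \<union> served_words r) = (\<lambda>e. C_count r e + P_count r e + S_count r e)"
  using state_disjoint[of r] state_subsets[of r]
  by (simp_all add: fun_eq_iff weight_count_Un[of _ r] C_count_def P_count_def S_count_def)

lemma shift_add: "shift (\<lambda>e. f e + g e) e = shift f e + shift g e"
  by (cases e) simp_all

text \<open>With \<open>x\<close> marking the weight and a prime for the step to
  \<open>Suc r\<close>, this recurrence is \<open>C' = (1 + x) (C + S)\<close>. The next two are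
  \<open>P' = (1 + x) (C + P)\<close> and
  \<open>S' = x (1 + x) (C + P + S) + (1 + x) S\<close>.\<close>

lemma C_count_Suc:
  "C_count (Suc r) e = C_count r e + S_count r e + shift (C_count r) e + shift (S_count r) e"
  unfolding C_count_def[of "Suc r"] closed_words_Suc
  using state_subsets[of r]
  by (subst weight_count_two_extensions(1)) (auto simp: weight_count_extend weight_count_unions shift_add)

lemma P_count_Suc:
  "P_count (Suc r) e = C_count r e + P_count r e + shift (C_count r) e + shift (P_count r) e"
  unfolding P_count_def[of "Suc r"] pending_words_Suc
  using state_subsets[of r]
  by (subst weight_count_two_extensions(1)) (auto simp: weight_count_extend weight_count_unions shift_add)

lemma S_count_Suc:
  "S_count (Suc r) e = shift (C_count r) e + shift (P_count r) e + S_count r e + 2 * shift (S_count r) e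
     + shift (shift (C_count r)) e + shift (shift (P_count r)) e + shift (shift (S_count r)) e"
proof -
  let ?U = "closed_words r \<union> pending_words r \<union> served_words r"
  let ?X = "\<Union>f\<in>{(True, True, False), (True, True, True)}. extend r f ` ?U"
  let ?Y = "\<Union>f\<in>{(False, True, False), (False, True, True)}. extend r f ` served_words r"
  have sub: "?U \<subseteq> words r" "served_words r \<subseteq> words r" using state_subsets[of r] by auto
  have "?X \<inter> ?Y = {}"
    by (rule extend_images_disjoint[OF sub]) simp
  moreover have "?X \<subseteq> words (Suc r)" "?Y \<subseteq> words (Suc r)"
    by (rule weight_count_two_extensions(2); use sub in auto)+
  ultimately have "S_count (Suc r) e = weight_count ?X e + weight_count ?Y e"
    unfolding S_count_def served_words_Suc by (intro weight_count_Un)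
  also have "weight_count ?X e = shift (weight_count ?U) e + shift (shift (weight_count ?U)) e"
    using sub by (subst weight_count_two_extensions(1)) (auto simp: weight_count_extend)
  also have "weight_count ?Y e = S_count r e + shift (S_count r) e"
    using sub by (subst weight_count_two_extensions(1)) (auto simp: weight_count_extend S_count_def)
  finally show ?thesis by (cases e) (simp_all add: weight_count_unions shift_add)
qed

lemma counts_0: "C_count 0 e = of_bool (e = 0)" "P_count 0 e = 0" "S_count 0 e = 0"
proof -
  have "closed_words 0 = {({}, {}, {})}" "pending_words 0 = {}" "served_words 0 = {}"
    by (auto simp: state_defs words_def runs_ok_def reach_def)
  moreover have "{T \<in> {({}, {}, {})}. weight T = e} = (if e = 0 then {({}, {}, {})} else {})"
    by (auto simp: weight_def)
  ultimately show "C_count 0 e = of_bool (e = 0)" "P_count 0 e = 0" "S_count 0 e = 0"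
    by (auto simp: C_count_def P_count_def S_count_def weight_count_def)
qed

lemma num_faces_eq_C_count: "int (num_faces d r) = C_count r (d + 1)"
proof -
  have "{(L, D, N). (L, D, N) \<in> closed_words r \<and> card L + card N = d + 1} = {T \<in> closed_words r. weight T = d + 1}"
    by (auto simp: weight_def)
  then show ?thesis
    by (simp add: num_faces_eq_card_patterns patterns_eq_closed_words C_count_def weight_count_def)
qed

section \<open>Integer-valued polynomials in Newton's binomial basis\<close>

definition binomial_poly :: "nat \<Rightarrow> (nat \<Rightarrow> int) \<Rightarrow> bool" where
  "binomial_poly m f \<longleftrightarrow> (\<exists>c. \<forall>r. f r = (\<Sum>k\<le>m. c k * int (r choose k)))"

lemma binomial_poly_mono:
  assumes "binomial_poly m f" "m \<le> n"
  shows "binomial_poly n f"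
proof -
  obtain c where c: "\<And>r. f r = (\<Sum>k\<le>m. c k * int (r choose k))"
    using assms(1) by (auto simp: binomial_poly_def)
  have "f r = (\<Sum>k\<le>n. (if k \<le> m then c k else 0) * int (r choose k))" for r
    unfolding c using assms(2) by (intro sum.mono_neutral_cong_left) auto
  then show ?thesis
    unfolding binomial_poly_def by (intro exI[of _ "\<lambda>k. if k \<le> m then c k else 0"]) blast
qed

lemma binomial_poly_add:
  assumes "binomial_poly m f" "binomial_poly m g"
  shows "binomial_poly m (\<lambda>r. f r + g r)"
proof -
  obtain c d where c: "\<And>r. f r = (\<Sum>k\<le>m. c k * int (r choose k))"
    and d: "\<And>r. g r = (\<Sum>k\<le>m. d k * int (r choose k))"
    using assms by (auto simp: binomial_poly_def)
  have "f r + g r = (\<Sum>k\<le>m. (c k + d k) * int (r choose k))" for r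
    by (simp add: c d sum.distrib algebra_simps)
  then show ?thesis unfolding binomial_poly_def by (intro exI[of _ "\<lambda>k. c k + d k"]) blast
qed

lemma binomial_poly_const: "(\<And>r. f r = f 0) \<Longrightarrow> binomial_poly 0 f"
  unfolding binomial_poly_def by (intro exI[of _ "\<lambda>_. f 0"]) simp

text \<open>Summation over \<open>r\<close> turns \<open>r choose k\<close> into
  \<open>r choose Suc k\<close> by Pascal's rule; the initial value \<open>f 0\<close> becomes the
  constant coefficient.\<close>

lemma binomial_poly_difference:
  assumes g: "binomial_poly m g" and f: "\<And>r. f (Suc r) = f r + g r"
  shows "binomial_poly (Suc m) f"
proof -
  obtain c where c: "\<And>r. g r = (\<Sum>k\<le>m. c k * int (r choose k))"
    using g by (auto simp: binomial_poly_def)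
  have "f r = f 0 + (\<Sum>k\<le>m. c k * int (r choose Suc k))" for r
    by (induction r) (simp_all add: f c sum.distrib algebra_simps)
  also have "f 0 + (\<Sum>k\<le>m. c k * int (r choose Suc k)) =
    (\<Sum>k\<le>Suc m. (case k of 0 \<Rightarrow> f 0 | Suc k' \<Rightarrow> c k') * int (r choose k))" for r
    by (subst sum.atMost_Suc_shift) simp
  finally show ?thesis
    unfolding binomial_poly_def by (intro exI[of _ "case_nat (f 0) c"]) blast
qed

text \<open>At weight \<open>Suc e\<close> the recurrences are solved in the order \<open>S\<close>,
  \<open>C\<close>, \<open>P\<close>: each difference involves smaller weights and the count solved
  just before, so the degree bounds are \<open>3 * e + 2\<close>, \<open>3 * e + 3\<close> and
  \<open>3 * e + 4\<close>. The fourth conjunct carries the weight \<open>e - 1\<close> terms that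
  the double shift in \<open>S\<close> needs.\<close>

lemma counts_binomial_poly:
  "binomial_poly (3 * e) (\<lambda>r. C_count r e) \<and> binomial_poly (3 * e + 1) (\<lambda>r. P_count r e) \<and>
   binomial_poly (3 * e + 1) (\<lambda>r. S_count r e) \<and>
   binomial_poly (3 * e + 1) (\<lambda>r. shift (C_count r) e + shift (P_count r) e + shift (S_count r) e)"
proof (induction e)
  case 0
  have S: "S_count r 0 = 0" for r
    by (induction r) (simp_all add: counts_0 S_count_Suc)
  have C: "C_count r 0 = 1" for r
    by (induction r) (simp_all add: counts_0 C_count_Suc S)
  have "binomial_poly (Suc 0) (\<lambda>r. P_count r 0)"
  proof (rule binomial_poly_difference)
    show "binomial_poly 0 (\<lambda>r. 1)" by (rule binomial_poly_const) simp
  qed (simp add: P_count_Suc C)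
  moreover have "binomial_poly m (\<lambda>r. a)" for m a
    by (rule binomial_poly_mono[of 0]) (auto intro: binomial_poly_const)
  ultimately show ?case by (simp add: S C)
next
  case (Suc e)
  let ?sh = "\<lambda>r. shift (C_count r) e + shift (P_count r) e + shift (S_count r) e"
  have C: "binomial_poly (3 * e + 1) (\<lambda>r. C_count r e)"
    using Suc by (auto intro: binomial_poly_mono)
  have P: "binomial_poly (3 * e + 1) (\<lambda>r. P_count r e)"
    and S: "binomial_poly (3 * e + 1) (\<lambda>r. S_count r e)" and sh: "binomial_poly (3 * e + 1) ?sh"
    using Suc by auto
  have S': "binomial_poly (Suc (3 * e + 1)) (\<lambda>r. S_count r (Suc e))"
  proof (rule binomial_poly_difference)
    show "binomial_poly (3 * e + 1) (\<lambda>r. C_count r e + (P_count r e + (S_count r e + (S_count r e + ?sh r))))"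
      by (intro binomial_poly_add C P S sh)
  qed (simp add: S_count_Suc)
  have C': "binomial_poly (Suc (Suc (3 * e + 1))) (\<lambda>r. C_count r (Suc e))"
  proof (rule binomial_poly_difference)
    show "binomial_poly (Suc (3 * e + 1)) (\<lambda>r. S_count r (Suc e) + (C_count r e + S_count r e))"
      by (intro binomial_poly_add S' binomial_poly_mono[OF C] binomial_poly_mono[OF S]) auto
  qed (simp add: C_count_Suc)
  have P': "binomial_poly (Suc (Suc (Suc (3 * e + 1)))) (\<lambda>r. P_count r (Suc e))"
  proof (rule binomial_poly_difference)
    show "binomial_poly (Suc (Suc (3 * e + 1))) (\<lambda>r. C_count r (Suc e) + (C_count r e + P_count r e))"
      by (intro binomial_poly_add C' binomial_poly_mono[OF C] binomial_poly_mono[OF P]) auto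
  qed (simp add: P_count_Suc)
  have "binomial_poly (3 * Suc e + 1) (\<lambda>r. C_count r e + P_count r e + S_count r e)"
    by (intro binomial_poly_add binomial_poly_mono[OF C] binomial_poly_mono[OF P] binomial_poly_mono[OF S]) auto
  then show ?case
    using binomial_poly_mono[OF C', of "3 * Suc e"] binomial_poly_mono[OF P', of "3 * Suc e + 1"]
      binomial_poly_mono[OF S', of "3 * Suc e + 1"] by simp
qed

text \<open>For \<open>r = m + 1\<close> the largest weight of a served word is
  \<open>2 * r\<close>, with all three sets full; a closed word loses \<open>r\<close> from
  \<open>N\<close>. For \<open>m > 0\<close> the value \<open>3 * m + 2\<close> counts the ways to
  drop one unit from the full served word: one of \<open>m + 1\<close> elements of \<open>L\<close>,
  one of \<open>m + 1\<close> elements of \<open>N\<close> only, or one of the \<open>m\<close>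
  positions before \<open>r\<close> from both \<open>D\<close> and \<open>N\<close>. For
  \<open>m = 0\<close> only the drop from \<open>N\<close> leaves the word served.\<close>

lemma counts_top:
  "(\<forall>e\<ge>2 * m + 2. C_count (Suc m) e = 0 \<and> P_count (Suc m) e = 0) \<and>
   (\<forall>e\<ge>2 * m + 3. S_count (Suc m) e = 0) \<and>
   C_count (Suc m) (2 * m + 1) = 1 \<and> S_count (Suc m) (2 * m + 2) = 1 \<and>
   P_count (Suc m) (2 * m + 1) = of_bool (m = 0) \<and>
   S_count (Suc m) (2 * m + 1) = (if m = 0 then 1 else 3 * int m + 2)"
proof (induction m)
  case 0
  show ?case
    by (auto simp: C_count_Suc P_count_Suc S_count_Suc counts_0 shift_def numeral_eq_Suc split: nat.splits)
next
  case (Suc m)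
  have "C_count (Suc (Suc m)) e = 0 \<and> P_count (Suc (Suc m)) e = 0" if "e \<ge> 2 * Suc m + 2" for e
  proof -
    define e' where "e' = e - 1"
    have "e = Suc e'" "e' \<ge> 2 * m + 3" using that by (simp_all add: e'_def)
    then show ?thesis using Suc by (simp add: C_count_Suc[of "Suc m"] P_count_Suc[of "Suc m"])
  qed
  moreover have "S_count (Suc (Suc m)) e = 0" if "e \<ge> 2 * Suc m + 3" for e
  proof -
    define e' where "e' = e - 2"
    have "e = Suc (Suc e')" "e' \<ge> 2 * m + 3" using that by (simp_all add: e'_def)
    then show ?thesis using Suc by (simp add: S_count_Suc[of "Suc m"])
  qed
  moreover have "2 * Suc m + 1 = Suc (2 * m + 2)" "2 * Suc m + 2 = Suc (Suc (2 * m + 2))" by simp_all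
  ultimately show ?case
    using Suc by (simp add: C_count_Suc[of "Suc m"] P_count_Suc[of "Suc m"] S_count_Suc[of "Suc m"])
qed


text \<open>Closed words of length \<open>r \<ge> 1\<close> have weight at most
  \<open>2 * r - 1\<close>, whereas \<open>r < d_min d\<close> means
  \<open>2 * r \<le> d + 1\<close>.\<close>

lemma num_faces_eq_0: "r < d_min d \<Longrightarrow> num_faces d r = 0"
proof (cases r)
  case 0
  then show ?thesis using num_faces_eq_C_count[of d 0] by (simp add: counts_0)
next
  case (Suc m)
  assume "r < d_min d"
  then have "d + 1 \<ge> 2 * m + 2" using Suc by (simp add: d_min_def)
  then show ?thesis using num_faces_eq_C_count[of d r] counts_top[of m] Suc by simp
qed

text \<open>For even \<open>d\<close> the weight \<open>d + 1\<close> is the largest possible for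
  closed words of length \<open>d_min d\<close>. For odd \<open>d\<close> it is one below the
  largest, and the recurrence for \<open>C_count\<close> adds 1 and 1 to the second highest count of
  served words.\<close>

lemma num_faces_d_min:
  "real (num_faces d (d_min d)) =
     (if odd d \<and> d > 1 then (3 * real d + 5) / 2 else if even d then 1 else 3)"
proof (cases "even d")
  case True
  then obtain m where m: "d = 2 * m" by blast
  then have "d_min d = Suc m" by (simp add: d_min_def)
  then have "int (num_faces d (d_min d)) = 1"
    using num_faces_eq_C_count[of d "Suc m"] counts_top[of m] m by simp
  then show ?thesis using True by simp
next
  case False
  then obtain m where m: "d = 2 * m + 1" by (metis oddE)
  then have "d_min d = Suc (Suc m)" "d + 1 = Suc (2 * m + 1)" by (simp_all add: d_min_def)
  then have "int (num_faces d (d_min d)) = C_count (Suc (Suc m)) (Suc (2 * m + 1))"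
    using num_faces_eq_C_count[of d "Suc (Suc m)"] by simp
  also have "\<dots> = (if m = 0 then 3 else 3 * int m + 4)"
    using counts_top[of m] by (simp add: C_count_Suc[of "Suc m"])
  finally have "real_of_int (int (num_faces d (d_min d))) = real_of_int (if m = 0 then 3 else 3 * int m + 4)"
    by simp
  then show ?thesis using m by (auto split: if_splits)
qed

text \<open>Evaluation at \<open>r = k\<close> gives a unitriangular system for the coefficients.
  Below \<open>d_min d\<close> its left-hand sides vanish, and from there on it is the recursion
  that defines \<open>alpha\<close>.\<close>

lemma alpha_eq_coefficient:
  assumes f: "\<And>r. int (num_faces d r) = (\<Sum>k\<le>M. c k * int (r choose k))"
  shows "k < d_min d \<Longrightarrow> k \<le> M \<Longrightarrow> c k = 0"
    and "d_min d \<le> k \<Longrightarrow> k \<le> M \<Longrightarrow> alpha d k = c k"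
proof -
  have f': "int (num_faces d k) = c k + (\<Sum>j<k. c j * int (k choose j))" if "k \<le> M" for k
  proof -
    have "int (num_faces d k) = (\<Sum>j\<le>k. c j * int (k choose j))"
      unfolding f using that by (intro sum.mono_neutral_right) auto
    also have "{..k} = insert k {..<k}" by auto
    finally show ?thesis by simp
  qed
  show zero: "c k = 0" if "k < d_min d" "k \<le> M" for k
    using that
  proof (induction k rule: less_induct)
    case (less k)
    then have "(\<Sum>j<k. c j * int (k choose j)) = 0" by (intro sum.neutral) auto
    with f'[of k] num_faces_eq_0[of k d] less.prems show ?case by simp
  qed
  show "alpha d k = c k" if "d_min d \<le> k" "k \<le> M"
    using that
  proof (induction k rule: less_induct)
    case (less k)
    have "(\<Sum>j\<in>{d_min d..<k}. int (k choose j) * alpha d j) = (\<Sum>j\<in>{d_min d..<k}. c j * int (k choose j))"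
      using less by (intro sum.cong) auto
    also have "\<dots> = (\<Sum>j<k. c j * int (k choose j))"
      using zero less.prems by (intro sum.mono_neutral_left) auto
    finally show ?case using f'[of k] less.prems by (subst alpha.simps) simp
  qed
qed

theorem theorem5p3:
  fixes d :: nat
  shows "(\<forall>r\<ge>1. int (num_faces d r) = (\<Sum>k = d_min d..3 * d + 3. alpha d k * int (r choose k)))
    \<and> (\<forall>k>d_min d. alpha d k = int (num_faces d k) - (\<Sum>j = d_min d..k - 1. int (k choose j) * alpha d j))
    \<and> alpha d (d_min d) = int (num_faces d (d_min d))
    \<and> real (num_faces d (d_min d)) =
        (if odd d \<and> d > 1 then (3 * real d + 5) / 2 else if even d then 1 else 3)"
proof (intro conjI allI impI)
  \<comment> \<open>Dimension \<open>d\<close> is weight \<open>d + 1\<close>, whence the upper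
    limit \<open>3 * d + 3\<close>.\<close>
  have "binomial_poly (3 * (d + 1)) (\<lambda>r. int (num_faces d r))"
    unfolding num_faces_eq_C_count using counts_binomial_poly by blast
  then obtain c where c: "\<And>r. int (num_faces d r) = (\<Sum>k\<le>3 * (d + 1). c k * int (r choose k))"
    unfolding binomial_poly_def by blast
  note coeff = alpha_eq_coefficient[where M = "3 * (d + 1)", OF c]
  fix r :: nat
  have "(\<Sum>k = d_min d..3 * d + 3. alpha d k * int (r choose k)) =
      (\<Sum>k = d_min d..3 * (d + 1). c k * int (r choose k))"
    using coeff(2) by (intro sum.cong) auto
  also have "\<dots> = (\<Sum>k\<le>3 * (d + 1). c k * int (r choose k))"
    using coeff(1) by (intro sum.mono_neutral_left) auto
  finally show "int (num_faces d r) = (\<Sum>k = d_min d..3 * d + 3. alpha d k * int (r choose k))"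
    using c by simp
next
  fix k assume "d_min d < k"
  then have "{d_min d..<k} = {d_min d..k - 1}" by auto
  then show "alpha d k = int (num_faces d k) - (\<Sum>j = d_min d..k - 1. int (k choose j) * alpha d j)"
    by (subst alpha.simps) simp
next
  show "alpha d (d_min d) = int (num_faces d (d_min d))" by (subst alpha.simps) simp
qed (rule num_faces_d_min)

end
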